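(* Let $\bm\mu^*\in\mathcal{P}(\mathbb{R}^d|\mathbb{T})$ be narrowly continuous and $\psi^*\in C^{1,2}_b(\mathbb{T}\times\mathbb{R}^d)$. Assume there exists a unique measurable $\phi:\mathbb{T}\times\mathbb{R}^d\to A$ such that $\phi(t,x)$ is the unique minimizer over $a\in A$ of $H\big(t,x,\nabla_x\psi^*(t,x),\mathrm{Hess}_x\psi^*(t,x),a,\mu^*_t\big)$ for all $(t,x)\in\mathbb{T}\times\mathbb{R}^d$; that $x\mapsto g(x,\mu^*_T)$ and $(t,x)\mapsto\min_{a\in A}H(t,x,\nabla_x\psi^*(t,x),\mathrm{Hess}_x\psi^*(t,x),a,\mu^*_t)$ are continuous; and that $\mathrm{supp}(\mu^*_t)=\mathbb{R}^d$ for all $t\in(0,T]$, where $\mathrm{supp}(\mu)=\{x:\mu(\{y:|y-x|<r\})>0\ \forall r>0\}$. Then for any $\xi^*\in\mathcal{M}_+(\mathbb{T}\times\mathbb{R}^d\times A)$, the triple $(\bm\mu^*,\xi^*,\psi^* )$ satisfies the primal-dual system (PD) below if and only if $\xi^*(\mathrm{d}t,\mathrm{d}x,\mathrm{d}a)=\delta_{\phi(t,x)}(\mathrm{d}a)\mu^*_t(\mathrm{d}x)\mathrm{d}t$ and (a) for all $\psi\in\mathcal{W}$: $\int\psi(T,x)\mu^*_T(\mathrm{d}x)-\int\psi(0,x)\rho(\mathrm{d}x)=\int_{\mathbb{T}\times\mathbb{R}^d}\big((\mathbb{L}^{\bm\mu^*}\psi)(t,x,\phi(t,x))+\partial_t\psi(t,x)\big)\mu^*_t(\mathrm{d}x)\mathrm{d}t$;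 (b) $\partial_t\psi^*(t,x)+\min_{a\in A}H(t,x,\nabla_x\psi^*(t,x),\mathrm{Hess}_x\psi^*(t,x),a,\mu^*_t)=0$ for all $(t,x)\in\mathbb{T}\times\mathbb{R}^d$, and $\psi^*(T,x)=g(x,\mu^*_T)$ for all $x\in\mathbb{R}^d$.
   Context: Let $T>0$, $\mathbb{T}=[0,T]$, $d\ge1$. $A$ is a Polish space; $b:\mathbb{T}\times\mathbb{R}^d\times A\times\mathcal{P}(\mathbb{R}^d)\to\mathbb{R}^d$, $\sigma:\ldots\to\mathbb{R}^{d\times d}$, $f:\ldots\to\mathbb{R}$ (same domain), $g:\mathbb{R}^d\times\mathcal{P}(\mathbb{R}^d)\to\mathbb{R}$ are bounded and Borel measurable ($\mathcal{P}(\mathbb{R}^d)$ with the weak topology). Fix $\rho\in\mathcal{P}(\mathbb{R}^d)$. $\mathcal{P}(\mathbb{R}^d|\mathbb{T})$: probability kernels $t\mapsto\mu_t$; narrowly continuous means $t\mapsto\int\varphi\,\mathrm{d}\mu_t$ is continuous for every bounded continuous $\varphi$. $\mathcal{M}_+(X)$: finite nonnegative Borel measures. $\mathcal{W}=C^{1,2}_b(\mathbb{T}\times\mathbb{R}^d)$: bounded continuous functions with $\partial_t,\nabla_x,\mathrm{Hess}_x$ existing, bounded, continuous. $(\mathbb{L}^{\bm\mu}\psi)(t,x,a)=\frac12\mathrm{tr}((\sigma\sigma^\top)(t,x,a,\mu_t)\mathrm{Hess}_x\psi(t,x))+b(t,x,a,\mu_t)^\top\nabla_x\psi(t,x)$.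 Hamiltonian: $H(t,x,y,z,a,\mu)=\frac12\mathrm{tr}((\sigma\sigma^\top)(t,x,a,\mu)z)+b(t,x,a,\mu)^\top y+f(t,x,a,\mu)$ for $y\in\mathbb{R}^d$, $z\in\mathbb{R}^{d\times d}$. Primal-dual system (PD) for $(\bm\mu^*,\xi^*,\psi^* )$: (i) $\int g(x,\mu^*_T)\mu^*_T(\mathrm{d}x)+\int f(t,x,a,\mu^*_t)\xi^*(\mathrm{d}t,\mathrm{d}x,\mathrm{d}a)=\int\psi^*(0,x)\rho(\mathrm{d}x)$; (ii) for all $\psi\in\mathcal{W}$, $\int\psi(T,x)\mu^*_T(\mathrm{d}x)-\int\psi(0,x)\rho(\mathrm{d}x)=\int\big((\mathbb{L}^{\bm\mu^*}\psi)(t,x,a)+\partial_t\psi(t,x)\big)\xi^*(\mathrm{d}t,\mathrm{d}x,\mathrm{d}a)$; (iii) $g(x,\mu^*_T)\ge\psi^*(T,x)$ for all $x$; (iv) $\partial_t\psi^*(t,x)+(\mathbb{L}^{\bm\mu^*}\psi^* )(t,x,a)+f(t,x,a,\mu^*_t)\ge0$ for all $(t,x,a)$; (v) for all $\psi\in\mathcal{W}$, $\int_{\mathbb{T}\times\mathbb{R}^d}\psi(t,x)\mu^*_t(\mathrm{d}x)\mathrm{d}t=\int\psi(t,x)\xi^*(\mathrm{d}t,\mathrm{d}x,\mathrm{d}a)$. *)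

theory Defs
  imports "HOL-Probability.Probability"
begin

text \<open>Conventions. Dimension d is encoded by a finite index type 'n (so R^d = real^'n),
the Polish action space A by a type 'a of class polish_space. Time t ranges over real,
only values on {0..T} matter. P(R^d) is the set of Borel probability measures on real^'n;
its Borel sigma algebra (weak topology) is the one generated by the evaluations m(B),
i.e. the (restricted) Giry sigma algebra subprob_algebra borel.\<close>

definition Pspace :: "('n::finite) itself \<Rightarrow> (real^'n) measure set" where
  "Pspace _ = {m. prob_space m \<and> sets m = sets borel}"

definition coeff_ok :: "real \<Rightarrow> (real \<Rightarrow> real^'n \<Rightarrow> 'a::polish_space \<Rightarrow> (real^'n) measure \<Rightarrow> 'b::euclidean_space) \<Rightarrow> bool" where
  "coeff_ok T h \<longleftrightarrow>
     bounded ((\<lambda>((t,x,a),m). h t x a m) ` (({0..T} \<times> UNIV) \<times> Pspace TYPE('n))) \<and>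
     (\<lambda>((t,x,a),m). h t x a m) \<in> measurable
        (restrict_space ((borel :: (real \<times> (real^'n) \<times> 'a) measure) \<Otimes>\<^sub>M subprob_algebra borel)
           (({0..T} \<times> UNIV) \<times> Pspace TYPE('n))) borel"

definition term_ok :: "(real^'n::finite \<Rightarrow> (real^'n) measure \<Rightarrow> real) \<Rightarrow> bool" where
  "term_ok g \<longleftrightarrow>
     bounded ((\<lambda>(x,m). g x m) ` (UNIV \<times> Pspace TYPE('n))) \<and>
     (\<lambda>(x,m). g x m) \<in> measurable
        (restrict_space ((borel :: (real^'n) measure) \<Otimes>\<^sub>M subprob_algebra borel)
           (UNIV \<times> Pspace TYPE('n))) borel"

definition prob_kernel :: "real \<Rightarrow> (real \<Rightarrow> (real^'n::finite) measure) \<Rightarrow> bool" where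
  "prob_kernel T \<mu> \<longleftrightarrow>
     (\<forall>t\<in>{0..T}. prob_space (\<mu> t) \<and> sets (\<mu> t) = sets borel) \<and>
     (\<forall>B\<in>sets borel. (\<lambda>t. emeasure (\<mu> t) B) \<in> borel_measurable (restrict_space lborel {0..T}))"

definition narrowly_continuous :: "real \<Rightarrow> (real \<Rightarrow> (real^'n::finite) measure) \<Rightarrow> bool" where
  "narrowly_continuous T \<mu> \<longleftrightarrow>
     (\<forall>\<phi>::real^'n \<Rightarrow> real. continuous_on UNIV \<phi> \<and> bounded (range \<phi>) \<longrightarrow>
        continuous_on {0..T} (\<lambda>t. integral\<^sup>L (\<mu> t) \<phi>))"

definition C12b :: "real \<Rightarrow> (real \<Rightarrow> real^'n::finite \<Rightarrow> real) \<Rightarrow> (real \<Rightarrow> real^'n \<Rightarrow> real)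
    \<Rightarrow> (real \<Rightarrow> real^'n \<Rightarrow> real^'n) \<Rightarrow> (real \<Rightarrow> real^'n \<Rightarrow> real^'n^'n) \<Rightarrow> bool" where
  "C12b T \<psi> \<psi>t \<psi>x \<psi>xx \<longleftrightarrow>
     continuous_on ({0..T} \<times> UNIV) (\<lambda>(t,x). \<psi> t x) \<and>
     continuous_on ({0..T} \<times> UNIV) (\<lambda>(t,x). \<psi>t t x) \<and>
     continuous_on ({0..T} \<times> UNIV) (\<lambda>(t,x). \<psi>x t x) \<and>
     continuous_on ({0..T} \<times> UNIV) (\<lambda>(t,x). \<psi>xx t x) \<and>
     bounded ((\<lambda>(t,x). \<psi> t x) ` ({0..T} \<times> UNIV)) \<and>
     bounded ((\<lambda>(t,x). \<psi>t t x) ` ({0..T} \<times> UNIV)) \<and>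
     bounded ((\<lambda>(t,x). \<psi>x t x) ` ({0..T} \<times> UNIV)) \<and>
     bounded ((\<lambda>(t,x). \<psi>xx t x) ` ({0..T} \<times> UNIV)) \<and>
     (\<forall>t\<in>{0..T}. \<forall>x.
        ((\<lambda>s. \<psi> s x) has_real_derivative \<psi>t t x) (at t within {0..T}) \<and>
        ((\<psi> t) has_derivative (\<lambda>h. \<psi>x t x \<bullet> h)) (at x) \<and>
        ((\<psi>x t) has_derivative (\<lambda>h. \<psi>xx t x *v h)) (at x))"

definition Lgen :: "(real \<Rightarrow> real^'n::finite \<Rightarrow> 'a \<Rightarrow> (real^'n) measure \<Rightarrow> real^'n)
    \<Rightarrow> (real \<Rightarrow> real^'n \<Rightarrow> 'a \<Rightarrow> (real^'n) measure \<Rightarrow> real^'n^'n)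
    \<Rightarrow> (real \<Rightarrow> (real^'n) measure)
    \<Rightarrow> (real \<Rightarrow> real^'n \<Rightarrow> real^'n) \<Rightarrow> (real \<Rightarrow> real^'n \<Rightarrow> real^'n^'n)
    \<Rightarrow> real \<Rightarrow> real^'n \<Rightarrow> 'a \<Rightarrow> real" where
  "Lgen b \<sigma> \<mu> \<psi>x \<psi>xx t x a =
     1/2 * trace ((\<sigma> t x a (\<mu> t) ** transpose (\<sigma> t x a (\<mu> t))) ** \<psi>xx t x)
     + b t x a (\<mu> t) \<bullet> \<psi>x t x"

definition Ham :: "(real \<Rightarrow> real^'n::finite \<Rightarrow> 'a \<Rightarrow> (real^'n) measure \<Rightarrow> real^'n)
    \<Rightarrow> (real \<Rightarrow> real^'n \<Rightarrow> 'a \<Rightarrow> (real^'n) measure \<Rightarrow> real^'n^'n)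
    \<Rightarrow> (real \<Rightarrow> real^'n \<Rightarrow> 'a \<Rightarrow> (real^'n) measure \<Rightarrow> real)
    \<Rightarrow> real \<Rightarrow> real^'n \<Rightarrow> real^'n \<Rightarrow> real^'n^'n \<Rightarrow> 'a \<Rightarrow> (real^'n) measure \<Rightarrow> real" where
  "Ham b \<sigma> f t x y z a m =
     1/2 * trace ((\<sigma> t x a m ** transpose (\<sigma> t x a m)) ** z) + b t x a m \<bullet> y + f t x a m"

definition supp :: "(real^'n::finite) measure \<Rightarrow> (real^'n) set" where
  "supp m = {x. \<forall>r>0. emeasure m (ball x r) > 0}"

definition tx_integral :: "real \<Rightarrow> (real \<Rightarrow> (real^'n::finite) measure) \<Rightarrow> (real \<Rightarrow> real^'n \<Rightarrow> real) \<Rightarrow> real" where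
  "tx_integral T \<mu> F = integral\<^sup>L (restrict_space lborel {0..T}) (\<lambda>t. integral\<^sup>L (\<mu> t) (F t))"

definition TXA :: "real \<Rightarrow> (real \<times> (real^'n::finite) \<times> 'a::polish_space) measure" where
  "TXA T = restrict_space borel ({0..T} \<times> UNIV)"

definition Mplus :: "real \<Rightarrow> (real \<times> (real^'n::finite) \<times> 'a::polish_space) measure set" where
  "Mplus T = {\<xi>. finite_measure \<xi> \<and> sets \<xi> = sets (TXA T)}"

definition PD :: "real \<Rightarrow> (real^'n::finite) measure
    \<Rightarrow> (real \<Rightarrow> real^'n \<Rightarrow> 'a::polish_space \<Rightarrow> (real^'n) measure \<Rightarrow> real^'n)
    \<Rightarrow> (real \<Rightarrow> real^'n \<Rightarrow> 'a \<Rightarrow> (real^'n) measure \<Rightarrow> real^'n^'n)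
    \<Rightarrow> (real \<Rightarrow> real^'n \<Rightarrow> 'a \<Rightarrow> (real^'n) measure \<Rightarrow> real)
    \<Rightarrow> (real^'n \<Rightarrow> (real^'n) measure \<Rightarrow> real)
    \<Rightarrow> (real \<Rightarrow> (real^'n) measure) \<Rightarrow> (real \<times> (real^'n) \<times> 'a) measure
    \<Rightarrow> (real \<Rightarrow> real^'n \<Rightarrow> real) \<Rightarrow> (real \<Rightarrow> real^'n \<Rightarrow> real)
    \<Rightarrow> (real \<Rightarrow> real^'n \<Rightarrow> real^'n) \<Rightarrow> (real \<Rightarrow> real^'n \<Rightarrow> real^'n^'n) \<Rightarrow> bool" where
  "PD T \<rho> b \<sigma> f g \<mu> \<xi> \<psi>s \<psi>st \<psi>sx \<psi>sxx \<longleftrightarrow>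
     \<comment> \<open>(i)\<close>
     integral\<^sup>L (\<mu> T) (\<lambda>x. g x (\<mu> T)) + integral\<^sup>L \<xi> (\<lambda>(t,x,a). f t x a (\<mu> t))
        = integral\<^sup>L \<rho> (\<lambda>x. \<psi>s 0 x) \<and>
     \<comment> \<open>(ii)\<close>
     (\<forall>\<psi> \<psi>t \<psi>x \<psi>xx. C12b T \<psi> \<psi>t \<psi>x \<psi>xx \<longrightarrow>
        integral\<^sup>L (\<mu> T) (\<lambda>x. \<psi> T x) - integral\<^sup>L \<rho> (\<lambda>x. \<psi> 0 x)
        = integral\<^sup>L \<xi> (\<lambda>(t,x,a). Lgen b \<sigma> \<mu> \<psi>x \<psi>xx t x a + \<psi>t t x)) \<and>
     \<comment> \<open>(iii)\<close>
     (\<forall>x. g x (\<mu> T) \<ge> \<psi>s T x) \<and>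
     \<comment> \<open>(iv)\<close>
     (\<forall>t\<in>{0..T}. \<forall>x a. \<psi>st t x + Lgen b \<sigma> \<mu> \<psi>sx \<psi>sxx t x a + f t x a (\<mu> t) \<ge> 0) \<and>
     \<comment> \<open>(v)\<close>
     (\<forall>\<psi> \<psi>t \<psi>x \<psi>xx. C12b T \<psi> \<psi>t \<psi>x \<psi>xx \<longrightarrow>
        tx_integral T \<mu> \<psi> = integral\<^sup>L \<xi> (\<lambda>(t,x,a). \<psi> t x))"

end

theory Submission
  imports Defs "HOL-Real_Asymp.Real_Asymp"
begin

text \<open>
Testing (ii) with \<open>\<psi>s\<close> and subtracting it from (i) gives
\<open>\<integral> (g - \<psi>s(T)) d\<mu>(T) + \<integral> F d\<xi> = 0\<close> for the defect \<open>F = \<partial>\<^sub>t\<psi>s + L\<psi>s + f\<close> of (iv). Both integrands are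
nonnegative by (iii) and (iv), so both vanish almost everywhere. As \<open>\<phi>\<close> is the unique minimiser of the
Hamiltonian, \<open>F = 0\<close> forces \<open>a = \<phi>(t,x)\<close> for \<open>\<xi>\<close>-almost every point, and (v) identifies the
\<open>(t,x)\<close>-marginal of \<open>\<xi>\<close>, because the test functions approximate indicators of closed orthants; hence \<open>\<xi>\<close> is
the measure carried by the graph of \<open>\<phi>\<close>. Full support and continuity turn the almost everywhere
equalities into equalities. Conversely, under (b) the defect \<open>F\<close> is nonnegative and vanishes on the graph.
\<close>

section \<open>Closure properties of the class of test functions\<close>

text \<open>Bounded sets have compact closure here, and a continuous image of the compact product of
  the two closures is bounded. This handles products, inner products and traces, which are
  continuous but not themselves bounded.\<close>

lemma bounded_image_continuous2:
  fixes h :: "'b::heine_borel \<Rightarrow> 'c::heine_borel \<Rightarrow> 'd::metric_space"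
  assumes "bounded (f ` S)" "bounded (g ` S)" and h: "continuous_on UNIV (case_prod h)"
  shows "bounded ((\<lambda>z. h (f z) (g z)) ` S)"
proof -
  have "compact (closure (f ` S) \<times> closure (g ` S))"
    using assms by (intro compact_Times) (auto simp: compact_closure)
  then have "compact (case_prod h ` (closure (f ` S) \<times> closure (g ` S)))"
    using h by (intro compact_continuous_image continuous_on_subset[OF h]) auto
  then have "bounded (case_prod h ` (closure (f ` S) \<times> closure (g ` S)))"
    by (rule compact_imp_bounded)
  moreover have "h (f z) (g z) \<in> case_prod h ` (closure (f ` S) \<times> closure (g ` S))" if "z \<in> S" for z
    using that closure_subset[of "f ` S"] closure_subset[of "g ` S"]
    by (intro image_eqI[of _ _ "(f z, g z)"]) auto
  ultimately show ?thesis
    by (rule bounded_subset[OF _ image_subsetI])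
qed

text \<open>Leibniz rule, with the derivatives written out because \<open>C12b\<close> takes them as
  arguments. The last Hessian term is the symmetrised outer product of the two gradients.\<close>

lemma C12b_mult:
  fixes u v :: "real \<Rightarrow> real^'n \<Rightarrow> real"
  assumes u: "C12b T u ut ux uxx" and v: "C12b T v vt vx vxx"
  shows "C12b T (\<lambda>t x. u t x * v t x) (\<lambda>t x. ut t x * v t x + u t x * vt t x)
    (\<lambda>t x. u t x *\<^sub>R vx t x + v t x *\<^sub>R ux t x)
    (\<lambda>t x. u t x *\<^sub>R vxx t x + v t x *\<^sub>R uxx t x
       + (\<chi> i j. vx t x $ i * ux t x $ j + ux t x $ i * vx t x $ j))"
proof -
  let ?S = "{0..T} \<times> (UNIV :: (real^'n) set)"
  have cont: "continuous_on ?S (\<lambda>(t,x). h (f t x) (k t x))"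
    if "continuous_on ?S (\<lambda>(t,x). f t x)" "continuous_on ?S (\<lambda>(t,x). k t x)"
      "continuous_on UNIV (case_prod h)"
    for f :: "real \<Rightarrow> real^'n \<Rightarrow> 'b::euclidean_space" and k :: "real \<Rightarrow> real^'n \<Rightarrow> 'c::euclidean_space"
      and h :: "'b \<Rightarrow> 'c \<Rightarrow> 'd::euclidean_space"
    using continuous_on_compose2[OF that(3) continuous_on_Pair[OF that(1,2)]]
    by (simp add: split_beta)
  have bdd: "bounded ((\<lambda>(t,x). h (f t x) (k t x)) ` ?S)"
    if "bounded ((\<lambda>(t,x). f t x) ` ?S)" "bounded ((\<lambda>(t,x). k t x) ` ?S)"
      "continuous_on UNIV (case_prod h)"
    for f :: "real \<Rightarrow> real^'n \<Rightarrow> 'b::euclidean_space" and k :: "real \<Rightarrow> real^'n \<Rightarrow> 'c::euclidean_space"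
      and h :: "'b \<Rightarrow> 'c \<Rightarrow> 'd::euclidean_space"
    using bounded_image_continuous2[OF that] by (simp add: split_beta)
  have c1: "continuous_on UNIV (case_prod ((*) :: real \<Rightarrow> real \<Rightarrow> real))"
    by (simp add: split_beta) (intro continuous_intros)
  have c2: "continuous_on UNIV (case_prod ((+) :: 'd::euclidean_space \<Rightarrow> 'd \<Rightarrow> 'd))"
    by (simp add: split_beta) (intro continuous_intros)
  have c3: "continuous_on UNIV (case_prod ((*\<^sub>R) :: real \<Rightarrow> 'd::euclidean_space \<Rightarrow> 'd))"
    by (simp add: split_beta) (intro continuous_intros)
  have c4: "continuous_on UNIV (case_prod (\<lambda>p q :: real^'n. \<chi> i j. p $ i * q $ j + q $ i * p $ j))"
    by (simp add: split_beta) (intro continuous_intros)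
  note U = u[unfolded C12b_def] and V = v[unfolded C12b_def]
  have d2: "((\<lambda>x. u t x *\<^sub>R vx t x + v t x *\<^sub>R ux t x) has_derivative
      (\<lambda>h. (u t x *\<^sub>R vxx t x + v t x *\<^sub>R uxx t x
       + (\<chi> i j. vx t x $ i * ux t x $ j + ux t x $ i * vx t x $ j)) *v h)) (at x)"
    if "t \<in> {0..T}" for t x
  proof -
    have "((\<lambda>x. u t x *\<^sub>R vx t x + v t x *\<^sub>R ux t x) has_derivative
      (\<lambda>h. (u t x *\<^sub>R (vxx t x *v h) + (ux t x \<bullet> h) *\<^sub>R vx t x)
         + (v t x *\<^sub>R (uxx t x *v h) + (vx t x \<bullet> h) *\<^sub>R ux t x))) (at x)"
      using U V that by (intro has_derivative_add has_derivative_scaleR) auto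
    \<comment> \<open>The symmetrised outer product acts on \<open>h\<close> exactly as the two
      cross terms of the Leibniz rule do.\<close>
    moreover have "(\<chi> i j. p $ i * q $ j + q $ i * p $ j) *v h = (q \<bullet> h) *\<^sub>R p + (p \<bullet> h) *\<^sub>R q"
      for p q h :: "real^'n"
      by (simp add: vec_eq_iff matrix_vector_mult_def inner_vec_def algebra_simps sum.distrib sum_distrib_left)
    ultimately show ?thesis
      by (simp add: matrix_vector_mult_add_rdistrib scaleR_matrix_vector_assoc[symmetric] algebra_simps)
  qed
  have d1: "((\<lambda>x. u t x * v t x) has_derivative (\<lambda>h. (u t x *\<^sub>R vx t x + v t x *\<^sub>R ux t x) \<bullet> h)) (at x)"
    if "t \<in> {0..T}" for t x
  proof -
    have "((\<lambda>x. u t x * v t x) has_derivative (\<lambda>h. u t x * (vx t x \<bullet> h) + (ux t x \<bullet> h) * v t x)) (at x)"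
      using U V that by (intro has_derivative_mult) auto
    then show ?thesis by (simp add: inner_add_left algebra_simps)
  qed
  have d0: "((\<lambda>s. u s x * v s x) has_real_derivative ut t x * v t x + u t x * vt t x) (at t within {0..T})"
    if "t \<in> {0..T}" for t x
    using U V that by (auto intro!: derivative_eq_intros)
  show ?thesis
    unfolding C12b_def
    apply (intro conjI ballI allI)
    subgoal by (intro cont[OF _ _ c1]) (simp_all only: U V)
    subgoal by (intro cont[OF _ _ c2] cont[OF _ _ c1]) (simp_all only: U V)
    subgoal by (intro cont[OF _ _ c2] cont[OF _ _ c3]) (simp_all only: U V)
    subgoal by (intro cont[OF _ _ c2] cont[OF _ _ c3] cont[OF _ _ c4]) (simp_all only: U V)
    subgoal by (intro bdd[OF _ _ c1]) (simp_all only: U V)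
    subgoal by (intro bdd[OF _ _ c2] bdd[OF _ _ c1]) (simp_all only: U V)
    subgoal by (intro bdd[OF _ _ c2] bdd[OF _ _ c3]) (simp_all only: U V)
    subgoal by (intro bdd[OF _ _ c2] bdd[OF _ _ c3] bdd[OF _ _ c4]) (simp_all only: U V)
    subgoal by (rule d0)
    subgoal by (rule d1)
    subgoal by (rule d2)
    done
qed

text \<open>Chain rule for a function of one scalar combination of time and space; the Hessian is a
  multiple of the rank-one matrix of \<open>w\<close>. Taking \<open>w = 0\<close> gives a function
  of time alone, and \<open>k = 0\<close> with \<open>w\<close> a unit vector a function of one
  coordinate, so one lemma serves all factors of the approximating products.\<close>

lemma C12b_ridge:
  fixes w :: "real^'n"
  assumes d1: "\<And>s. (\<theta> has_real_derivative \<theta>' s) (at s)"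
    and d2: "\<And>s. (\<theta>' has_real_derivative \<theta>'' s) (at s)"
    and c: "continuous_on UNIV \<theta>''"
    and b: "bounded (range \<theta>)" "bounded (range \<theta>')" "bounded (range \<theta>'')"
  shows "C12b T (\<lambda>t x. \<theta> (k * t + w \<bullet> x)) (\<lambda>t x. k * \<theta>' (k * t + w \<bullet> x))
    (\<lambda>t x. \<theta>' (k * t + w \<bullet> x) *\<^sub>R w) (\<lambda>t x. \<theta>'' (k * t + w \<bullet> x) *\<^sub>R (\<chi> i j. w $ i * w $ j))"
proof -
  have c': "continuous_on UNIV \<theta>" "continuous_on UNIV \<theta>'"
    using d1 d2 by (auto intro!: DERIV_continuous_on simp: has_field_derivative_at_within)
  have cc: "continuous_on ({0..T} \<times> UNIV) (\<lambda>p. f (k * fst p + w \<bullet> snd p))"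
    if "continuous_on UNIV f" for f :: "real \<Rightarrow> real"
    by (rule continuous_on_compose2[OF that]) (auto intro!: continuous_intros)
  have "bounded ((\<lambda>p. f (k * fst p + w \<bullet> snd p)) ` ({0..T} \<times> (UNIV :: (real^'n) set)))"
    if "bounded (range f)" for f :: "real \<Rightarrow> real"
    by (rule bounded_subset[OF that]) auto
  note bb = this[OF b(1)] this[OF b(2)] this[OF b(3)]
  have bs: "bounded ((\<lambda>p. f p *\<^sub>R z) ` S)" if "bounded (f ` S)" for f :: "'z \<Rightarrow> real" and z :: "'y::real_normed_vector" and S
    using bounded_linear_image[OF that bounded_linear_scaleR_left, of z] by (simp add: image_image)
  have "((\<lambda>x. \<theta>' (k * t + w \<bullet> x) *\<^sub>R w) has_derivative
      (\<lambda>h. (\<theta>'' (k * t + w \<bullet> x) *\<^sub>R (\<chi> i j. w $ i * w $ j)) *v h)) (at x)" for t x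
  proof -
    have "((\<lambda>x. \<theta>' (k * t + w \<bullet> x)) has_derivative (\<lambda>h. (w \<bullet> h) * \<theta>'' (k * t + w \<bullet> x))) (at x)"
      by (rule DERIV_compose_FDERIV[OF d2]) (auto intro!: derivative_eq_intros)
    then have "((\<lambda>x. \<theta>' (k * t + w \<bullet> x) *\<^sub>R w) has_derivative (\<lambda>h. ((w \<bullet> h) * \<theta>'' (k * t + w \<bullet> x)) *\<^sub>R w)) (at x)"
      by (rule has_derivative_scaleR_left)
    moreover have "(\<chi> i j. w $ i * w $ j) *v h = (w \<bullet> h) *\<^sub>R w" for h
      by (simp add: vec_eq_iff matrix_vector_mult_def inner_vec_def algebra_simps sum_distrib_left)
    then have "(\<theta>'' (k * t + w \<bullet> x) *\<^sub>R (\<chi> i j. w $ i * w $ j)) *v h = ((w \<bullet> h) * \<theta>'' (k * t + w \<bullet> x)) *\<^sub>R w" for h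
      by (simp add: scaleR_matrix_vector_assoc[symmetric] mult.commute)
    ultimately show ?thesis by simp
  qed
  moreover have "((\<lambda>x. \<theta> (k * t + w \<bullet> x)) has_derivative (\<lambda>h. (\<theta>' (k * t + w \<bullet> x) *\<^sub>R w) \<bullet> h)) (at x)" for t x
    by (rule DERIV_compose_FDERIV[OF d1, THEN has_derivative_eq_rhs]) (auto intro!: derivative_eq_intros simp: mult.commute)
  moreover have "((\<lambda>s. \<theta> (k * s + w \<bullet> x)) has_real_derivative k * \<theta>' (k * t + w \<bullet> x)) (at t within {0..T})" for t x
    by (rule DERIV_chain2[OF d1, THEN DERIV_cong]) (auto intro!: derivative_eq_intros)
  ultimately show ?thesis
    unfolding C12b_def case_prod_unfold
    apply (intro conjI ballI allI)
    subgoal by (rule cc[OF c'(1)])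
    subgoal by (rule continuous_on_mult_left[OF cc[OF c'(2)]])
    subgoal by (rule continuous_on_scaleR[OF cc[OF c'(2)] continuous_on_const])
    subgoal by (rule continuous_on_scaleR[OF cc[OF c] continuous_on_const])
    subgoal by (rule bb(1))
    subgoal using bs[OF bb(2), of k] by (simp add: mult.commute)
    subgoal by (rule bs[OF bb(2)])
    subgoal by (rule bs[OF bb(3)])
    subgoal by blast
    subgoal by blast
    subgoal by blast
    done
qed

text \<open>Iterates \<open>C12b_mult\<close>. The derivatives stay existential, since only
  membership in the class matters for the approximation of indicators.\<close>

lemma C12b_prod:
  assumes "finite I" "\<And>i. i \<in> I \<Longrightarrow> \<exists>ut ux uxx. C12b T (u i) ut ux uxx"
  shows "\<exists>ut ux uxx. C12b T (\<lambda>t x. \<Prod>i\<in>I. u i t x) ut ux uxx"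
  using assms
proof (induction I)
  case empty
  have "C12b T (\<lambda>t x. 1) (\<lambda>t x. 0) (\<lambda>t x. 0) (\<lambda>t x. 0)"
    unfolding C12b_def by (auto intro!: derivative_eq_intros simp: image_constant_conv)
  then show ?case by auto
next
  case (insert i I)
  obtain ct cx cxx where "C12b T (u i) ct cx cxx"
    using insert.prems by blast
  moreover obtain bt bx bxx where "C12b T (\<lambda>t x. \<Prod>i\<in>I. u i t x) bt bx bxx"
    using insert.IH insert.prems by blast
  ultimately show ?case
    using C12b_mult insert.hyps by (subst prod.insert) blast+
qed

section \<open>Smooth approximation of indicators of orthants\<close>

text \<open>A smooth decreasing step for \<open>n > 0\<close>, with centre at \<open>1/n\<close>.
  The arctangent has bounded derivatives on the whole line, so no cutoff is required; the slope
  \<open>n^2\<close> dominates the shift \<open>n\<close> as soon as \<open>s > 0\<close>.\<close>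

definition arcstep :: "nat \<Rightarrow> real \<Rightarrow> real" where
  "arcstep n s = 1/2 + arctan (real n - (real n)\<^sup>2 * s) / pi"

lemma arcstep_bounds: "0 \<le> arcstep n s" "arcstep n s \<le> 1"
proof -
  have "\<bar>arctan (real n - (real n)\<^sup>2 * s)\<bar> \<le> pi / 2"
    using arctan_bounded[of "real n - (real n)\<^sup>2 * s"] by linarith
  then show "0 \<le> arcstep n s" "arcstep n s \<le> 1"
    by (auto simp: arcstep_def field_simps abs_le_iff)
qed

text \<open>The shift by n inside arctan makes the limit at the jump s = 0 equal to 1.\<close>

lemma arcstep_tendsto: "(\<lambda>n. arcstep n s) \<longlonglongrightarrow> indicator {..0} s"
proof (cases "s \<le> 0")
  case True
  have "filterlim (\<lambda>n. real n - (real n)\<^sup>2 * s) at_top sequentially"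
    by (rule filterlim_at_top_mono[OF filterlim_real_sequentially])
       (use True in \<open>auto simp: mult_nonneg_nonpos\<close>)
  then have "(\<lambda>n. arctan (real n - (real n)\<^sup>2 * s)) \<longlonglongrightarrow> pi / 2"
    by (rule filterlim_compose[OF tendsto_arctan_at_top])
  then have "(\<lambda>n. arcstep n s) \<longlonglongrightarrow> 1/2 + (pi / 2) / pi"
    unfolding arcstep_def by (intro tendsto_intros) auto
  with True show ?thesis by simp
next
  case False
  then have "s > 0" by simp
  then have "filterlim (\<lambda>n. real n - (real n)\<^sup>2 * s) at_bot sequentially"
    by real_asymp
  then have "(\<lambda>n. arctan (real n - (real n)\<^sup>2 * s)) \<longlonglongrightarrow> - (pi / 2)"
    by (rule filterlim_compose[OF tendsto_arctan_at_bot])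
  then have "(\<lambda>n. arcstep n s) \<longlonglongrightarrow> 1/2 + (- (pi / 2)) / pi"
    unfolding arcstep_def by (intro tendsto_intros) auto
  with False show ?thesis by simp
qed

text \<open>With \<open>r\<close> the argument of the arctangent and \<open>q = 1 + r^2\<close>, the
  first two derivatives are constant multiples of \<open>1/q\<close> and \<open>r/q^2\<close>. Both
  quotients have absolute value at most 1, because \<open>q \<ge> 1\<close> and
  \<open>\<bar>r\<bar> \<le> 1 + r^2 \<le> q^2\<close>.\<close>

lemma C12b_arcstep:
  fixes w :: "real^'n"
  shows "\<exists>ut ux uxx. C12b T (\<lambda>t x. arcstep n (k * t + w \<bullet> x - c)) ut ux uxx"
proof -
  define r where "r s = real n - (real n)\<^sup>2 * (s - c)" for s
  define q where "q s = 1 + (r s)\<^sup>2" for s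
  define \<theta>' where "\<theta>' s = - (real n)\<^sup>2 / pi * inverse (q s)" for s
  define \<theta>'' where "\<theta>'' s = - 2 * (real n)^4 / pi * (r s / (q s)\<^sup>2)" for s
  have pos: "q s \<ge> 1" for s by (simp add: q_def)
  then have nz: "q s \<noteq> 0" for s by (smt (verit))
  have dr: "(r has_real_derivative - (real n)\<^sup>2) (at s)" for s
    unfolding r_def by (auto intro!: derivative_eq_intros)
  have dq: "(q has_real_derivative - 2 * r s * (real n)\<^sup>2) (at s)" for s
    unfolding q_def by (rule derivative_eq_intros dr refl | simp)+
  have d1: "((\<lambda>s. arcstep n (s - c)) has_real_derivative \<theta>' s) (at s)" for s
  proof -
    have "((\<lambda>s. arcstep n (s - c)) has_real_derivative
        0 + inverse (1 + (r s)\<^sup>2) * (- (real n)\<^sup>2) / pi) (at s)"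
      unfolding arcstep_def r_def[symmetric]
      by (intro DERIV_add DERIV_const DERIV_cdivide DERIV_chain2[OF DERIV_arctan dr])
    moreover have "0 + inverse (1 + (r s)\<^sup>2) * (- (real n)\<^sup>2) / pi = \<theta>' s"
      by (simp add: \<theta>'_def q_def)
    ultimately show ?thesis by simp
  qed
  have d2: "(\<theta>' has_real_derivative \<theta>'' s) (at s)" for s
  proof -
    have "((\<lambda>s. - (real n)\<^sup>2 / pi * inverse (q s)) has_real_derivative
        - (real n)\<^sup>2 / pi * - (inverse (q s) * (- 2 * r s * (real n)\<^sup>2) * inverse (q s))) (at s)"
      by (intro DERIV_cmult DERIV_inverse' dq nz)
    moreover have "- (real n)\<^sup>2 / pi * - (inverse (q s) * (- 2 * r s * (real n)\<^sup>2) * inverse (q s)) = \<theta>'' s"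
      by (simp add: \<theta>''_def power2_eq_square power4_eq_xxxx divide_inverse)
    ultimately show ?thesis by (simp add: \<theta>'_def[abs_def])
  qed
  have cr: "continuous_on UNIV r" unfolding r_def by (intro continuous_intros)
  have c: "continuous_on UNIV \<theta>''"
    unfolding \<theta>''_def q_def using nz[unfolded q_def] by (intro continuous_intros cr) auto
  have "bounded (range (\<lambda>s. arcstep n (s - c)))"
    unfolding bounded_iff using arcstep_bounds by (auto intro!: exI[of _ 1])
  moreover have "bounded (range \<theta>')"
  proof -
    have "inverse (q s) \<in> {0..1}" for s
      using pos[of s] by (auto simp: inverse_le_1_iff)
    then have "range (inverse \<circ> q) \<subseteq> {0..1}" by auto
    then have "bounded (range (inverse \<circ> q))"
      by (rule bounded_subset[OF bounded_closed_interval])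
    from bounded_linear_image[OF this bounded_linear_mult_right[of "- (real n)\<^sup>2 / pi"]]
    show ?thesis by (simp add: image_image \<theta>'_def)
  qed
  moreover have "bounded (range \<theta>'')"
  proof -
    have "r s / (q s)\<^sup>2 \<in> {-1..1}" for s
    proof -
      have "\<bar>r s\<bar> * 1 \<le> 1 + (r s)\<^sup>2"
        using sum_squares_bound[of "\<bar>r s\<bar>" 1] zero_le_power2[of "r s"] by simp
      also have "\<dots> \<le> (q s)\<^sup>2"
        using mult_left_mono[OF pos[of s], of "q s"] pos[of s] by (simp add: q_def power2_eq_square)
      finally have "\<bar>r s\<bar> \<le> (q s)\<^sup>2" by simp
      moreover have "(q s)\<^sup>2 > 0" using nz by simp
      ultimately show ?thesis by (auto simp: divide_simps)
    qed
    then have "range (\<lambda>s. r s / (q s)\<^sup>2) \<subseteq> {-1..1}" by auto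
    then have "bounded (range (\<lambda>s. r s / (q s)\<^sup>2))"
      by (rule bounded_subset[OF bounded_closed_interval])
    from bounded_linear_image[OF this bounded_linear_mult_right[of "- 2 * (real n)^4 / pi"]]
    show ?thesis by (simp add: image_image \<theta>''_def mult.commute[of _ pi])
  qed
  ultimately show ?thesis
    using C12b_ridge[OF d1 d2 c, where T=T and k=k and w=w] by blast
qed

text \<open>The order on \<open>real \<times> real^'n\<close> is componentwise, so the indicator of
  a closed orthant is a product of one-dimensional step indicators, one for time and one for each
  coordinate. Replacing each factor by \<open>arcstep n\<close> preserves the range
  \<open>{0..1}\<close> and the pointwise limit.\<close>

lemma C12b_approximates_orthant:
  fixes y :: "real^'n"
  shows "\<exists>u. (\<forall>n. \<exists>ut ux uxx. C12b T (u n) ut ux uxx) \<and> (\<forall>n t x. u n t x \<in> {0..1}) \<and>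
    (\<forall>t x. (\<lambda>n. u n t x) \<longlonglongrightarrow> indicator {..(s,y)} (t,x))"
proof -
  define u where "u n t x = arcstep n (t - s) * (\<Prod>i\<in>UNIV. arcstep n (x $ i - y $ i))" for n t and x :: "real^'n"
  have "\<exists>ut ux uxx. C12b T (u n) ut ux uxx" for n
  proof -
    have "\<exists>ut ux uxx. C12b T (\<lambda>t (x::real^'n). arcstep n (t - s)) ut ux uxx"
      using C12b_arcstep[of T n 1 0 s] by simp
    moreover have "\<exists>ut ux uxx. C12b T (\<lambda>t x. arcstep n (x $ i - y $ i)) ut ux uxx" for i
      using C12b_arcstep[of T n 0 "axis i 1" "y $ i"] by (simp add: inner_axis')
    then have "\<exists>ut ux uxx. C12b T (\<lambda>t x. \<Prod>i\<in>UNIV. arcstep n (x $ i - y $ i)) ut ux uxx"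
      by (intro C12b_prod) auto
    ultimately show ?thesis
      unfolding u_def using C12b_mult by blast
  qed
  moreover have "u n t x \<in> {0..1}" for n t x
    unfolding u_def
    by (auto intro!: mult_nonneg_nonneg prod_nonneg mult_le_one prod_le_1 simp: arcstep_bounds)
  moreover have "(\<lambda>n. u n t x) \<longlonglongrightarrow> indicator {..(s,y)} (t,x)" for t x
  proof -
    have "(\<lambda>n. u n t x) \<longlonglongrightarrow> indicator {..0} (t - s) * (\<Prod>i\<in>UNIV. indicator {..0} (x $ i - y $ i))"
      unfolding u_def by (intro tendsto_intros arcstep_tendsto)
    also have "indicator {..0} (t - s) * (\<Prod>i\<in>UNIV. indicator {..0} (x $ i - y $ i)) = (indicator {..(s,y)} (t,x) :: real)"
      by (auto simp: indicator_def less_eq_vec_def prod.If_cases prod_zero_iff split: if_splits)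
    finally show ?thesis .
  qed
  ultimately show ?thesis by blast
qed

section \<open>Test functions determine finite measures on the strip\<close>

text \<open>Closed orthants are stable under intersection (the corner becomes the componentwise
  \<open>inf\<close>) and generate the Borel sets. The orthants with corner
  \<open>(n, ..., n)\<close> have finite measure and exhaust the space, so the uniqueness theorem
  for generators applies.\<close>

lemma finite_measure_eqI_atMost:
  fixes M N :: "(real \<times> (real^'n::finite)) measure"
  assumes "finite_measure M" and sM: "sets M = sets borel" and sN: "sets N = sets borel"
    and eq: "\<And>s y. emeasure M {..(s,y)} = emeasure N {..(s,y)}"
  shows "M = N"
proof -
  interpret M: finite_measure M by fact
  let ?E = "range (\<lambda>a :: real \<times> (real^'n). {..a})"
  let ?A = "\<lambda>n::nat. {..(real n, \<chi> i::'n. real n)}"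
  have borel: "sets (borel :: (real \<times> (real^'n)) measure) = sigma_sets UNIV ?E"
    by (subst borel_eq_atMost) simp
  show ?thesis
  proof (rule measure_eqI_generator_eq[where E="?E" and \<Omega>=UNIV and A="?A"])
    have "{..a} \<inter> {..b} = {..inf a b}" for a b :: "real \<times> (real^'n)" by auto
    then show "Int_stable ?E" by (auto simp: Int_stable_def)
    have "(t, x) \<in> (\<Union>n. ?A n)" for t and x :: "real^'n"
    proof -
      obtain n where n: "max t (norm x) \<le> real n" using real_arch_simple by blast
      have "x $ i \<le> real n" for i
        using component_le_norm_cart[of x i] n by auto
      with n show ?thesis by (auto simp: less_eq_vec_def)
    qed
    then show "(\<Union>n. ?A n) = UNIV" by auto
    show "emeasure M (?A n) \<noteq> \<infinity>" for n by simp
  qed (use eq sM sN borel in auto)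
qed

text \<open>Dominated convergence along the functions of \<open>C12b_approximates_orthant\<close>,
  all bounded by 1 on a finite measure, yields the mass of every closed orthant under the image
  measures. The projection \<open>P\<close> is kept abstract so that measures on the state-action
  space can be compared through their \<open>(t,x)\<close> part.\<close>

lemma C12b_integrals_determine_marginal:
  fixes M N :: "'b measure" and P :: "'b \<Rightarrow> real \<times> (real^'n::finite)"
  assumes M: "finite_measure M" and N: "finite_measure N"
    and P: "P \<in> borel_measurable M" and P': "P \<in> borel_measurable N"
    and eq: "\<And>u ut ux uxx. C12b T u ut ux uxx \<Longrightarrow>
      (\<integral>p. u (fst (P p)) (snd (P p)) \<partial>M) = (\<integral>p. u (fst (P p)) (snd (P p)) \<partial>N)"
    and range: "P ` space M \<subseteq> {0..T} \<times> UNIV" "P ` space N \<subseteq> {0..T} \<times> UNIV"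
  shows "distr M borel P = distr N borel P"
proof (rule finite_measure_eqI_atMost)
  interpret M: finite_measure M by fact
  interpret N: finite_measure N by fact
  interpret M': finite_measure "distr M borel P" using P by (rule M.finite_measure_distr)
  interpret N': finite_measure "distr N borel P" using P' by (rule N.finite_measure_distr)
  show "finite_measure (distr M borel P)" by unfold_locales
  fix s :: real and y :: "real^'n"
  let ?Q = "{..(s,y)}"
  obtain u where u: "\<And>n. \<exists>ut ux uxx. C12b T (u n) ut ux uxx" "\<And>n t x. u n t x \<in> {0..1}"
    "\<And>t x. (\<lambda>n. u n t x) \<longlonglongrightarrow> indicator ?Q (t,x)"
    using C12b_approximates_orthant[of T s y] by blast
  have lim: "(\<lambda>n. \<integral>p. u n (fst (P p)) (snd (P p)) \<partial>L) \<longlonglongrightarrow> measure (distr L borel P) ?Q"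
    if L: "finite_measure L" "P \<in> borel_measurable L" and PL: "P ` space L \<subseteq> {0..T} \<times> UNIV" for L
  proof -
    interpret L: finite_measure L by fact
    note [measurable] = L(2)
    have "(\<lambda>n. \<integral>p. u n (fst (P p)) (snd (P p)) \<partial>L) \<longlonglongrightarrow> (\<integral>p. indicat_real ?Q (P p) \<partial>L)"
    proof (rule integral_dominated_convergence[where w="\<lambda>_. 1"])
      \<comment> \<open>\<open>C12b\<close> controls a function only on the strip
        \<open>{0..T} \<times> UNIV\<close>; measurability of the composition therefore uses that
        \<open>P\<close> takes its values there.\<close>
      show "(\<lambda>p. u n (fst (P p)) (snd (P p))) \<in> borel_measurable L" for n
      proof -
        obtain ut ux uxx where "C12b T (u n) ut ux uxx" using u(1) by blast
        then have "continuous_on ({0..T} \<times> UNIV) (\<lambda>(t,x). u n t x)"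
          by (simp add: C12b_def)
        then have "(\<lambda>(t,x). u n t x) \<in> borel_measurable (restrict_space borel ({0..T} \<times> UNIV))"
          by (rule borel_measurable_continuous_on_restrict)
        moreover have "P \<in> measurable L (restrict_space borel ({0..T} \<times> UNIV))"
          using PL by (intro measurable_restrict_space2) auto
        ultimately have "(\<lambda>p. (\<lambda>(t,x). u n t x) (P p)) \<in> borel_measurable L"
          by (rule measurable_compose[rotated])
        then show ?thesis by (simp add: case_prod_unfold)
      qed
      show "AE p in L. (\<lambda>n. u n (fst (P p)) (snd (P p))) \<longlonglongrightarrow> indicator ?Q (P p)"
        by (rule AE_I2) (metis u(3) prod.collapse)
      show "AE p in L. norm (u n (fst (P p)) (snd (P p))) \<le> 1" for n
        using u(2) by simp
    qed auto
    also have "(\<integral>p. indicat_real ?Q (P p) \<partial>L) = (\<integral>q. indicat_real ?Q q \<partial>distr L borel P)"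
      using integral_distr[OF L(2), of "indicator ?Q :: _ \<Rightarrow> real"] by simp
    also have "\<dots> = measure (distr L borel P) ?Q" by simp
    finally show ?thesis .
  qed
  have "(\<integral>p. u n (fst (P p)) (snd (P p)) \<partial>M) = (\<integral>p. u n (fst (P p)) (snd (P p)) \<partial>N)" for n
    using u(1) eq by blast
  then have "measure (distr M borel P) ?Q = measure (distr N borel P) ?Q"
    using lim[OF M P range(1)] lim[OF N P' range(2)] LIMSEQ_unique by simp
  then show "emeasure (distr M borel P) ?Q = emeasure (distr N borel P) ?Q"
    by (simp add: M'.emeasure_eq_measure N'.emeasure_eq_measure)
qed auto

section \<open>From almost everywhere to everywhere\<close>

text \<open>The set where \<open>u\<close> and \<open>v\<close> differ is open. If it were nonempty
  it would contain a ball, which would be null, against full support.\<close>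

lemma supp_UNIV_AE_continuous_eq:
  fixes u v :: "real^'n::finite \<Rightarrow> real"
  assumes m: "sets m = sets borel" "supp m = UNIV"
    and c: "continuous_on UNIV u" "continuous_on UNIV v" and ae: "AE x in m. u x = v x"
  shows "u x = v x"
proof (rule ccontr)
  assume "u x \<noteq> v x"
  moreover have "open {x. u x \<noteq> v x}" using c by (rule open_Collect_neq)
  ultimately obtain r where r: "r > 0" "ball x r \<subseteq> {x. u x \<noteq> v x}"
    using openE by blast
  have "AE y in m. y \<notin> ball x r" using ae by eventually_elim (use r in auto)
  then have "emeasure m (ball x r) = 0"
    using m by (subst (asm) AE_iff_null_sets[symmetric]) auto
  moreover have "x \<in> supp m" using m by simp
  ultimately show False using r by (auto simp: supp_def)
qed

text \<open>The function \<open>\<bar>u\<bar>\<close> is continuous and nonnegative with integral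
  zero over an interval which has nonempty interior because \<open>0 < T\<close>.\<close>

lemma AE_continuous_zero_imp_zero:
  fixes u :: "real \<Rightarrow> real"
  assumes "0 < T" and c: "continuous_on {0..T} u" and ae: "AE t in restrict_space lborel {0..T}. u t = 0"
    and t: "t \<in> {0..T}"
  shows "u t = 0"
proof -
  have "AE t in lborel. t \<in> {0..T} \<longrightarrow> \<bar>u t\<bar> = 0"
    using ae by (simp add: AE_restrict_space_iff)
  then have "((\<lambda>t. \<bar>u t\<bar>) has_integral 0) {0..T}"
    by (subst has_integral_AE[where g="\<lambda>_. 0"]) auto
  then have "\<bar>u t\<bar> = 0"
    using assms by (intro has_integral_0_cbox_imp_0[of 0 T]) (auto intro!: continuous_intros)
  then show ?thesis by simp
qed

section \<open>Test functions as functions on the state-action space\<close>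

lemma continuous_on_measurable_TXA:
  fixes w :: "real \<Rightarrow> real^'n \<Rightarrow> 'z::topological_space"
  assumes "continuous_on ({0..T} \<times> UNIV) (\<lambda>(t,x). w t x)"
  shows "(\<lambda>(t,x,a). w t x) \<in> borel_measurable (TXA T)"
proof -
  have "continuous_on ({0..T} \<times> UNIV) (\<lambda>p. (\<lambda>(t,x). w t x) (fst p, fst (snd p)))"
    by (rule continuous_on_compose2[OF assms]) (auto intro!: continuous_intros)
  then show ?thesis
    unfolding TXA_def by (intro borel_measurable_continuous_on_restrict) (simp add: case_prod_unfold)
qed

lemma C12b_measurable:
  fixes u :: "real \<Rightarrow> real^'n \<Rightarrow> real"
  assumes "C12b T u ut ux uxx"
  shows "(\<lambda>(t,x,a). u t x) \<in> borel_measurable (TXA T)" "(\<lambda>(t,x,a). ut t x) \<in> borel_measurable (TXA T)"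
    "(\<lambda>(t,x,a). ux t x) \<in> borel_measurable (TXA T)" "(\<lambda>(t,x,a). uxx t x) \<in> borel_measurable (TXA T)"
proof -
  show "(\<lambda>(t,x,a). u t x) \<in> borel_measurable (TXA T)" "(\<lambda>(t,x,a). ut t x) \<in> borel_measurable (TXA T)"
    "(\<lambda>(t,x,a). ux t x) \<in> borel_measurable (TXA T)" "(\<lambda>(t,x,a). uxx t x) \<in> borel_measurable (TXA T)"
    using assms unfolding C12b_def by (auto intro!: continuous_on_measurable_TXA)
qed

lemma C12b_bounded:
  fixes u :: "real \<Rightarrow> real^'n \<Rightarrow> real"
  assumes "C12b T u ut ux uxx"
  shows "bounded ((\<lambda>(t,x,a). u t x) ` ({0..T} \<times> UNIV))" "bounded ((\<lambda>(t,x,a). ut t x) ` ({0..T} \<times> UNIV))"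
    "bounded ((\<lambda>(t,x,a). ux t x) ` ({0..T} \<times> UNIV))" "bounded ((\<lambda>(t,x,a). uxx t x) ` ({0..T} \<times> UNIV))"
proof -
  have "bounded ((\<lambda>(t,x,a). w t x) ` ({0..T} \<times> UNIV))"
    if "bounded ((\<lambda>(t,x). w t x) ` ({0..T} \<times> UNIV))" for w :: "real \<Rightarrow> real^'n \<Rightarrow> 'z::metric_space"
    using that by (rule bounded_subset) force
  then show "bounded ((\<lambda>(t,x,a). u t x) ` ({0..T} \<times> UNIV))" "bounded ((\<lambda>(t,x,a). ut t x) ` ({0..T} \<times> UNIV))"
    "bounded ((\<lambda>(t,x,a). ux t x) ` ({0..T} \<times> UNIV))" "bounded ((\<lambda>(t,x,a). uxx t x) ` ({0..T} \<times> UNIV))"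
    using assms unfolding C12b_def by blast+
qed

section \<open>The measure carried by the graph of a feedback\<close>

text \<open>This is the measure \<open>\<delta>_{\<phi>(t,x)}(da) \<mu>_t(dx) dt\<close>. Writing it
  as a monadic bind gives access to the rules for integrals and null sets of kernel
  compositions.\<close>

definition graph_measure :: "real \<Rightarrow> (real \<Rightarrow> (real^'n::finite) measure) \<Rightarrow> (real \<Rightarrow> real^'n \<Rightarrow> 'a::polish_space)
    \<Rightarrow> (real \<times> (real^'n) \<times> 'a) measure" where
  "graph_measure T \<mu> \<phi> =
     restrict_space lborel {0..T} \<bind> (\<lambda>t. distr (\<mu> t) (TXA T) (\<lambda>x. (t, x, \<phi> t x)))"

locale feedback_kernel =
  fixes T :: real and \<mu> :: "real \<Rightarrow> (real^'n::finite) measure" and \<phi> :: "real \<Rightarrow> real^'n \<Rightarrow> 'a::polish_space"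
  assumes T_pos: "T > 0" and kernel: "prob_kernel T \<mu>"
    and \<phi>_meas: "(\<lambda>(t,x). \<phi> t x) \<in> measurable (restrict_space borel ({0..T} \<times> UNIV)) borel"
begin

lemma \<mu>_prob: "t \<in> {0..T} \<Longrightarrow> prob_space (\<mu> t)" and \<mu>_sets: "t \<in> {0..T} \<Longrightarrow> sets (\<mu> t) = sets borel"
  using kernel by (auto simp: prob_kernel_def)

lemma \<mu>_Pspace: "t \<in> {0..T} \<Longrightarrow> \<mu> t \<in> Pspace TYPE('n)"
  using \<mu>_prob \<mu>_sets by (simp add: Pspace_def)

abbreviation "time \<equiv> restrict_space lborel {0..T}"

lemma space_time: "space time = {0..T}"
  by (simp add: space_restrict_space)

lemma finite_time: "finite_measure time"
  by (rule finite_measureI) (use T_pos in \<open>simp add: emeasure_restrict_space space_time\<close>)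

text \<open>The evaluations on Borel sets generate the Giry sigma algebra, so the setwise
  measurability in \<open>prob_kernel\<close> suffices.\<close>

lemma measurable_\<mu> [measurable]: "\<mu> \<in> measurable time (subprob_algebra borel)"
  using kernel \<mu>_prob \<mu>_sets
  by (intro measurable_subprob_algebra) (auto simp: space_time prob_kernel_def intro: prob_space_imp_subprob_space)

lemma space_TXA: "space (TXA T :: (real \<times> (real^'n) \<times> 'a) measure) = {0..T} \<times> UNIV"
  by (simp add: TXA_def space_restrict_space)

lemma measurable_graph_pair:
  "(\<lambda>(t, x). (t, x, \<phi> t x)) \<in> measurable (restrict_space borel ({0..T} \<times> UNIV)) (TXA T)"
proof -
  have [measurable]: "(\<lambda>p. \<phi> (fst p) (snd p)) \<in> measurable (restrict_space borel ({0..T} \<times> UNIV)) borel"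
    using \<phi>_meas by (simp add: case_prod_unfold)
  have [measurable]: "fst \<in> borel_measurable (restrict_space borel ({0..T} \<times> (UNIV :: (real^'n) set)))"
    "snd \<in> borel_measurable (restrict_space borel ({0..T} \<times> (UNIV :: (real^'n) set)))"
    by (auto intro!: borel_measurable_continuous_on_restrict continuous_intros)
  show ?thesis
    unfolding TXA_def case_prod_unfold
    by (intro measurable_restrict_space2 borel_measurable_Pair) (auto simp: space_restrict_space)
qed

text \<open>The map of \<open>measurable_graph_pair\<close> with a product sigma algebra as source,
  the form in which \<open>measurable_distr2\<close> takes it. The version on the trace of the Borel
  sets is used to pull sets back to the strip.\<close>

lemma measurable_graph [measurable]:
  "(\<lambda>(t, x). (t, x, \<phi> t x)) \<in> measurable (time \<Otimes>\<^sub>M borel) (TXA T)"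
proof -
  have "(\<lambda>p. p) \<in> measurable (time \<Otimes>\<^sub>M borel) (restrict_space borel ({0..T} \<times> (UNIV :: (real^'n) set)))"
  proof (rule measurable_restrict_space2)
    have "fst \<in> measurable (time \<Otimes>\<^sub>M (borel :: (real^'n) measure)) borel"
      by (rule measurable_compose[OF measurable_fst]) (simp add: measurable_restrict_space1)
    then have "(\<lambda>p. (fst p, snd p)) \<in> borel_measurable (time \<Otimes>\<^sub>M (borel :: (real^'n) measure))"
      by (intro borel_measurable_Pair) simp_all
    then show "(\<lambda>p. p) \<in> borel_measurable (time \<Otimes>\<^sub>M (borel :: (real^'n) measure))"
      by simp
  qed (auto simp: space_pair_measure space_time)
  from measurable_compose[OF this measurable_graph_pair] show ?thesis .
qed

lemma measurable_graph_section: "t \<in> {0..T} \<Longrightarrow> (\<lambda>x. (t, x, \<phi> t x)) \<in> measurable (\<mu> t) (TXA T)"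
  using measurable_compose[OF measurable_Pair1' measurable_graph, of t] 
  by (simp add: space_time \<mu>_sets cong: measurable_cong_sets)

lemma measurable_graph_kernel [measurable]:
  "(\<lambda>t. distr (\<mu> t) (TXA T) (\<lambda>x. (t, x, \<phi> t x))) \<in> measurable time (subprob_algebra (TXA T))"
  by (rule measurable_distr2[OF measurable_graph measurable_\<mu>])

lemma time_nonempty: "space time \<noteq> {}"
  using T_pos by (simp add: space_time)

lemma sets_graph_measure: "sets (graph_measure T \<mu> \<phi>) = sets (TXA T)"
  unfolding graph_measure_def by (rule sets_bind_measurable[OF measurable_graph_kernel time_nonempty])

text \<open>The right-hand side is the form in which the theorem describes \<open>\<xi>\<close>; it
  results from evaluating first the bind and then the image measure of each slice.\<close>

lemma emeasure_graph_measure: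
  assumes E: "E \<in> sets (TXA T)"
  shows "emeasure (graph_measure T \<mu> \<phi>) E =
    (\<integral>\<^sup>+ t. indicator {0..T} t * (\<integral>\<^sup>+ x. indicator E (t, x, \<phi> t x) \<partial>\<mu> t) \<partial>lborel)"
proof -
  have "emeasure (graph_measure T \<mu> \<phi>) E = (\<integral>\<^sup>+t. emeasure (distr (\<mu> t) (TXA T) (\<lambda>x. (t, x, \<phi> t x))) E \<partial>time)"
    unfolding graph_measure_def by (rule emeasure_bind[OF time_nonempty measurable_graph_kernel E])
  also have "\<dots> = (\<integral>\<^sup>+t. (\<integral>\<^sup>+ x. indicator E (t, x, \<phi> t x) \<partial>\<mu> t) \<partial>time)"
  proof (rule nn_integral_cong)
    fix t assume "t \<in> space time"
    then have "(\<lambda>x. (t, x, \<phi> t x)) \<in> measurable (\<mu> t) (TXA T)"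
      using measurable_graph_section by (simp add: space_time)
    from nn_integral_distr[OF this, of "indicator E"]
    show "emeasure (distr (\<mu> t) (TXA T) (\<lambda>x. (t, x, \<phi> t x))) E = (\<integral>\<^sup>+ x. indicator E (t, x, \<phi> t x) \<partial>\<mu> t)"
      using E by simp
  qed
  also have "\<dots> = (\<integral>\<^sup>+ t. indicator {0..T} t * (\<integral>\<^sup>+ x. indicator E (t, x, \<phi> t x) \<partial>\<mu> t) \<partial>lborel)"
    by (subst nn_integral_restrict_space) (auto simp: mult.commute)
  finally show ?thesis .
qed

text \<open>Each slice has mass one, so the total mass is the length of the time interval.\<close>

lemma finite_graph_measure: "finite_measure (graph_measure T \<mu> \<phi>)"
proof (rule finite_measureI)
  have "space (graph_measure T \<mu> \<phi>) = space (TXA T)"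
    by (rule sets_eq_imp_space_eq[OF sets_graph_measure])
  then have "emeasure (graph_measure T \<mu> \<phi>) (space (graph_measure T \<mu> \<phi>)) =
      (\<integral>\<^sup>+ t. indicator {0..T} t * (\<integral>\<^sup>+ x. indicator ({0..T} \<times> UNIV) (t, x, \<phi> t x) \<partial>\<mu> t) \<partial>lborel)"
    using emeasure_graph_measure[OF sets.top] by (simp add: space_TXA)
  also have "\<dots> = (\<integral>\<^sup>+ t. indicator {0..T} t \<partial>lborel)"
    by (intro nn_integral_cong) (auto simp: indicator_def prob_space.emeasure_space_1[OF \<mu>_prob])
  also have "\<dots> < \<infinity>" using T_pos by simp
  finally show "emeasure (graph_measure T \<mu> \<phi>) (space (graph_measure T \<mu> \<phi>)) \<noteq> \<infinity>" by simp
qed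

text \<open>Integration over a bind for real-valued integrands: the bind is the join of the image of
  \<open>time\<close> under the kernel, and \<open>integral_join\<close> applies because
  \<open>G\<close> is bounded, \<open>time\<close> is finite and the kernel has mass at most
  1.\<close>

lemma integral_graph_measure:
  assumes G [measurable]: "G \<in> borel_measurable (TXA T)" and b: "bounded (G ` ({0..T} \<times> UNIV))"
  shows "integral\<^sup>L (graph_measure T \<mu> \<phi>) G = tx_integral T \<mu> (\<lambda>t x. G (t, x, \<phi> t x))"
proof -
  let ?K = "\<lambda>t. distr (\<mu> t) (TXA T) (\<lambda>x. (t, x, \<phi> t x))"
  let ?D = "distr time (subprob_algebra (TXA T)) ?K"
  obtain B where B: "\<And>p. p \<in> {0..T} \<times> UNIV \<Longrightarrow> \<bar>G p\<bar> \<le> B"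
    using b by (auto simp: bounded_iff)
  have "integral\<^sup>L (graph_measure T \<mu> \<phi>) G = integral\<^sup>L (join ?D) G"
    by (simp add: graph_measure_def bind_nonempty''[OF measurable_graph_kernel time_nonempty])
  also have "\<dots> = (\<integral>M. integral\<^sup>L M G \<partial>?D)"
  proof (rule integral_join[where B=B and B'=1 and N="TXA T"])
    show "finite_measure ?D"
      by (rule finite_measure.finite_measure_distr[OF finite_time measurable_graph_kernel])
    show "AE M in ?D. emeasure M (space M) \<le> ennreal 1"
      by (rule AE_I2) (auto simp: space_subprob_algebra subprob_space.emeasure_space_le_1)
  qed (use B in \<open>auto simp: space_TXA\<close>)
  also have "\<dots> = (\<integral>t. integral\<^sup>L (?K t) G \<partial>time)"
    by (rule integral_distr) auto
  also have "\<dots> = (\<integral>t. (\<integral>x. G (t, x, \<phi> t x) \<partial>\<mu> t) \<partial>time)"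
    by (rule Bochner_Integration.integral_cong)
       (auto simp: space_time intro!: integral_distr[OF measurable_graph_section])
  finally show ?thesis by (simp add: tx_integral_def)
qed

text \<open>Fubini for null sets. It transfers an almost everywhere statement to almost every time
  slice, where full support can act.\<close>

lemma AE_graph_measure:
  assumes P: "Measurable.pred (TXA T) P" and ae: "AE p in graph_measure T \<mu> \<phi>. P p"
  shows "AE t in time. AE x in \<mu> t. P (t, x, \<phi> t x)"
proof -
  have "AE t in time. AE p in distr (\<mu> t) (TXA T) (\<lambda>x. (t, x, \<phi> t x)). P p"
    using ae unfolding graph_measure_def by (subst (asm) AE_bind[OF measurable_graph_kernel P])
  moreover have "AE t in time. t \<in> {0..T}" by (rule AE_I2) (simp add: space_time)
  ultimately show ?thesis
    by eventually_elim
      (use P in \<open>subst (asm) AE_distr_iff[OF measurable_graph_section]\<close>, auto simp: pred_def)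
qed

text \<open>A measure concentrated on the graph of \<open>\<phi>\<close> is determined by its
  \<open>(t,x)\<close>-marginal, since up to a null set every \<open>E\<close> is a cylinder over
  its preimage under the graph map. The test function identity fixes that marginal.\<close>

lemma graph_measure_eqI:
  assumes fin: "finite_measure \<xi>" and sets: "sets \<xi> = sets (TXA T)"
    and ae: "AE p in \<xi>. snd (snd p) = \<phi> (fst p) (fst (snd p))"
    and eq: "\<And>u ut ux uxx. C12b T u ut ux uxx \<Longrightarrow>
      tx_integral T \<mu> u = integral\<^sup>L \<xi> (\<lambda>(t,x,a). u t x)"
  shows "\<xi> = graph_measure T \<mu> \<phi>"
proof (rule measure_eqI)
  let ?\<nu> = "graph_measure T \<mu> \<phi>"
  let ?P = "\<lambda>(t, x, a :: 'a). (t, x) :: real \<times> (real^'n)"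
  note sets\<nu> = sets_graph_measure
  have sp: "space \<xi> = {0..T} \<times> UNIV" "space ?\<nu> = {0..T} \<times> UNIV"
    using sets_eq_imp_space_eq[OF sets] sets_eq_imp_space_eq[OF sets\<nu>] by (simp_all add: space_TXA)
  have "?P \<in> borel_measurable (TXA T :: (real \<times> (real^'n) \<times> 'a) measure)"
    unfolding TXA_def case_prod_unfold
    by (intro borel_measurable_continuous_on_restrict continuous_intros)
  then have P: "?P \<in> borel_measurable \<xi>" "?P \<in> borel_measurable ?\<nu>"
    by (simp_all add: sets sets\<nu> cong: measurable_cong_sets)
  have marginal: "distr \<xi> borel ?P = distr ?\<nu> borel ?P"
  proof (rule C12b_integrals_determine_marginal[OF fin finite_graph_measure P])
    fix u :: "real \<Rightarrow> real^'n \<Rightarrow> real" and ut ux uxx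
    assume u: "C12b T u ut ux uxx"
    show "(\<integral>p. u (fst (?P p)) (snd (?P p)) \<partial>\<xi>) = (\<integral>p. u (fst (?P p)) (snd (?P p)) \<partial>?\<nu>)"
      using eq[OF u] integral_graph_measure[OF C12b_measurable(1)[OF u] C12b_bounded(1)[OF u]]
      by (simp add: case_prod_unfold)
  qed (auto simp: sp)
  show "sets \<xi> = sets ?\<nu>" by (simp add: sets sets\<nu>)
  fix E assume "E \<in> sets \<xi>"
  then have E: "E \<in> sets (TXA T)" using sets by simp
  \<comment> \<open>The base of the cylinder: the points of the strip whose graph point lies in
    \<open>E\<close>.\<close>
  define E' where "E' = {p \<in> {0..T} \<times> UNIV. (fst p, snd p, \<phi> (fst p) (snd p)) \<in> E}"
  have "E' \<in> sets (restrict_space borel ({0..T} \<times> UNIV))"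
    using measurable_sets[OF measurable_graph_pair E]
    by (simp add: E'_def vimage_def space_restrict_space case_prod_unfold Int_def conj_commute)
  \<comment> \<open>The strip is closed, so measurability in its trace sigma algebra gives a Borel
    set of the whole space, on which the marginals are defined.\<close>
  then have E': "E' \<in> sets borel"
    by (subst (asm) sets_restrict_space_iff) (auto intro!: borel_closed closed_Times)
  let ?F = "?P -` E' \<inter> {0..T} \<times> UNIV"
  have F: "?F \<in> sets (TXA T)"
    using measurable_sets[OF P(1) E'] sp sets by simp
  have "emeasure \<xi> E = emeasure \<xi> ?F"
  proof (rule emeasure_eq_AE)
    have "AE p in \<xi>. p \<in> {0..T} \<times> UNIV" by (rule AE_I2) (simp add: sp)
    with ae show "AE p in \<xi>. p \<in> E \<longleftrightarrow> p \<in> ?F"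
      by eventually_elim (auto simp: E'_def)
  qed (use E F sets in auto)
  also have "\<dots> = emeasure (distr \<xi> borel ?P) E'"
    using emeasure_distr[OF P(1) E'] by (simp add: sp)
  also have "\<dots> = emeasure ?\<nu> ?F"
    using emeasure_distr[OF P(2) E'] by (simp add: sp marginal)
  \<comment> \<open>The iterated integral evaluates both sets at graph points only, and there they
    agree pointwise.\<close>
  also have "\<dots> = emeasure ?\<nu> E"
    unfolding emeasure_graph_measure[OF F] emeasure_graph_measure[OF E]
    by (intro nn_integral_cong) (auto simp: E'_def indicator_def)
  finally show "emeasure \<xi> E = emeasure ?\<nu> E" .
qed

end

section \<open>Coefficients and generator along the flow of measures\<close>

text \<open>Composition with \<open>p \<mapsto> (p, \<mu> (fst p))\<close>, which is measurable into
  the Borel sets times the Giry sigma algebra and takes its values in the set on which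
  \<open>coeff_ok\<close> makes its claims.\<close>

lemma (in feedback_kernel) coeff_ok_along_\<mu>:
  fixes h :: "real \<Rightarrow> real^'n \<Rightarrow> 'a \<Rightarrow> (real^'n) measure \<Rightarrow> 'z::euclidean_space"
  assumes "coeff_ok T h"
  shows "(\<lambda>(t,x,a). h t x a (\<mu> t)) \<in> borel_measurable (TXA T)"
    and "bounded ((\<lambda>(t,x,a). h t x a (\<mu> t)) ` ({0..T} \<times> UNIV))"
proof -
  let ?S = "({0..T} \<times> (UNIV :: ((real^'n) \<times> 'a) set)) \<times> Pspace TYPE('n)"
  have "fst \<in> measurable (TXA T :: (real \<times> (real^'n) \<times> 'a) measure) time"
  proof (rule measurable_restrict_space2)
    show "fst \<in> space (TXA T :: (real \<times> (real^'n) \<times> 'a) measure) \<rightarrow> {0..T}" by (auto simp: space_TXA)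
    have "fst \<in> borel_measurable (TXA T :: (real \<times> (real^'n) \<times> 'a) measure)"
      unfolding TXA_def by (intro borel_measurable_continuous_on_restrict continuous_intros)
    then show "fst \<in> measurable (TXA T :: (real \<times> (real^'n) \<times> 'a) measure) lborel" by simp
  qed
  then have "(\<lambda>p. \<mu> (fst p)) \<in> measurable (TXA T :: (real \<times> (real^'n) \<times> 'a) measure) (subprob_algebra borel)"
    by (rule measurable_compose[OF _ measurable_\<mu>])
  moreover have "(\<lambda>p. p) \<in> measurable (TXA T) (borel :: (real \<times> (real^'n) \<times> 'a) measure)"
    unfolding TXA_def by (intro measurable_restrict_space1) simp
  ultimately have "(\<lambda>p. (p, \<mu> (fst p))) \<in> measurable (TXA T)
      (restrict_space ((borel :: (real \<times> (real^'n) \<times> 'a) measure) \<Otimes>\<^sub>M subprob_algebra borel) ?S)"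
    by (intro measurable_restrict_space2 measurable_Pair) (auto simp: space_TXA \<mu>_Pspace)
  moreover have "(\<lambda>((t,x,a),m). h t x a m) \<in> measurable
      (restrict_space ((borel :: (real \<times> (real^'n) \<times> 'a) measure) \<Otimes>\<^sub>M subprob_algebra borel) ?S) borel"
    using assms by (simp add: coeff_ok_def)
  ultimately have "(\<lambda>p. (\<lambda>((t,x,a),m). h t x a m) (p, \<mu> (fst p))) \<in> borel_measurable (TXA T)"
    by (rule measurable_compose)
  then show "(\<lambda>(t,x,a). h t x a (\<mu> t)) \<in> borel_measurable (TXA T)"
    by (simp add: case_prod_unfold)
  have "bounded ((\<lambda>((t,x,a),m). h t x a m) ` ?S)"
    using assms by (simp add: coeff_ok_def)
  moreover have "(\<lambda>(t,x,a). h t x a (\<mu> t)) p \<in> (\<lambda>((t,x,a),m). h t x a m) ` ?S" if "p \<in> {0..T} \<times> UNIV" for p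
    using that \<mu>_Pspace by (intro image_eqI[of _ _ "(p, \<mu> (fst p))"]) (auto simp: case_prod_unfold)
  ultimately show "bounded ((\<lambda>(t,x,a). h t x a (\<mu> t)) ` ({0..T} \<times> UNIV))"
    by (rule bounded_subset[OF _ image_subsetI])
qed

text \<open>The generator is a sum of two continuous expressions, a trace and an inner product, in
  coefficients and derivatives that are measurable and bounded.\<close>

lemma (in feedback_kernel) Lgen_measurable_bounded:
  fixes b :: "real \<Rightarrow> real^'n \<Rightarrow> 'a \<Rightarrow> (real^'n) measure \<Rightarrow> real^'n"
    and \<sigma> :: "real \<Rightarrow> real^'n \<Rightarrow> 'a \<Rightarrow> (real^'n) measure \<Rightarrow> real^'n^'n"
  assumes b: "coeff_ok T b" and \<sigma>: "coeff_ok T \<sigma>" and u: "C12b T u ut ux uxx"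
  shows "(\<lambda>(t,x,a). Lgen b \<sigma> \<mu> ux uxx t x a) \<in> borel_measurable (TXA T)"
    and "bounded ((\<lambda>(t,x,a). Lgen b \<sigma> \<mu> ux uxx t x a) ` ({0..T} \<times> UNIV))"
proof -
  define H :: "real^'n^'n \<Rightarrow> real^'n^'n \<Rightarrow> real" where "H s z = 1/2 * trace ((s ** transpose s) ** z)" for s z
  have cH: "continuous_on UNIV (\<lambda>p. H (fst p) (snd p))"
    unfolding H_def trace_def matrix_matrix_mult_def transpose_def
    by (simp, intro continuous_intros) simp
  have cI: "continuous_on UNIV (\<lambda>p. fst p \<bullet> (snd p :: real^'n))"
    by (intro continuous_intros)
  have L: "(\<lambda>(t,x,a). Lgen b \<sigma> \<mu> ux uxx t x a) =
     (\<lambda>p. H ((\<lambda>(t,x,a). \<sigma> t x a (\<mu> t)) p) ((\<lambda>(t,x,a). uxx t x) p)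
        + (\<lambda>(t,x,a). b t x a (\<mu> t)) p \<bullet> (\<lambda>(t,x,a). ux t x) p)"
    by (auto simp: Lgen_def H_def)
  show "(\<lambda>(t,x,a). Lgen b \<sigma> \<mu> ux uxx t x a) \<in> borel_measurable (TXA T)"
    unfolding L
    by (rule borel_measurable_add
      [OF borel_measurable_continuous_Pair[where H=H, OF coeff_ok_along_\<mu>(1)[OF \<sigma>] C12b_measurable(4)[OF u] cH]
          borel_measurable_continuous_Pair[where H=inner, OF coeff_ok_along_\<mu>(1)[OF b] C12b_measurable(3)[OF u] cI]])
  show "bounded ((\<lambda>(t,x,a). Lgen b \<sigma> \<mu> ux uxx t x a) ` ({0..T} \<times> UNIV))"
    unfolding L
    by (rule bounded_plus_comp
      [OF bounded_image_continuous2[where h=H, OF coeff_ok_along_\<mu>(2)[OF \<sigma>] C12b_bounded(4)[OF u]]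
          bounded_image_continuous2[where h=inner, OF coeff_ok_along_\<mu>(2)[OF b] C12b_bounded(3)[OF u]]])
       (use cH cI in \<open>simp_all add: case_prod_unfold\<close>)
qed

lemma integrable_Mplus:
  assumes "\<xi> \<in> Mplus T" and G: "G \<in> borel_measurable (TXA T)" and b: "bounded (G ` ({0..T} \<times> UNIV))"
  shows "integrable \<xi> (G :: _ \<Rightarrow> real)"
proof -
  have fin: "finite_measure \<xi>" and s: "sets \<xi> = sets (TXA T)" using assms by (auto simp: Mplus_def)
  obtain B where "\<And>p. p \<in> {0..T} \<times> UNIV \<Longrightarrow> norm (G p) \<le> B"
    using b by (auto simp: bounded_iff)
  moreover have "space \<xi> = {0..T} \<times> UNIV"
    using sets_eq_imp_space_eq[OF s] by (simp add: TXA_def space_restrict_space)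
  ultimately show ?thesis
    using G s by (intro finite_measure.integrable_const_bound[OF fin, where B=B] AE_I2)
      (auto cong: measurable_cong_sets)
qed

section \<open>Equivalence of the primal-dual system with the coupled forward and backward
  equations\<close>

theorem theorem6p1:
  fixes T :: real
    and \<rho> :: "(real^'n::finite) measure"
    and b :: "real \<Rightarrow> real^'n \<Rightarrow> 'a::polish_space \<Rightarrow> (real^'n) measure \<Rightarrow> real^'n"
    and \<sigma> :: "real \<Rightarrow> real^'n \<Rightarrow> 'a \<Rightarrow> (real^'n) measure \<Rightarrow> real^'n^'n"
    and f :: "real \<Rightarrow> real^'n \<Rightarrow> 'a \<Rightarrow> (real^'n) measure \<Rightarrow> real"
    and g :: "real^'n \<Rightarrow> (real^'n) measure \<Rightarrow> real"
    and \<mu> :: "real \<Rightarrow> (real^'n) measure"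
    and \<psi>s \<psi>st :: "real \<Rightarrow> real^'n \<Rightarrow> real"
    and \<psi>sx :: "real \<Rightarrow> real^'n \<Rightarrow> real^'n"
    and \<psi>sxx :: "real \<Rightarrow> real^'n \<Rightarrow> real^'n^'n"
    and \<phi> :: "real \<Rightarrow> real^'n \<Rightarrow> 'a"
    and \<xi> :: "(real \<times> (real^'n) \<times> 'a) measure"
  assumes T_pos: "T > 0"
    and b_ok: "coeff_ok T b" and \<sigma>_ok: "coeff_ok T \<sigma>" and f_ok: "coeff_ok T f"
    and g_ok: "term_ok g"
    and \<rho>_prob: "prob_space \<rho>" and \<rho>_sets: "sets \<rho> = sets borel"
    and \<mu>_kernel: "prob_kernel T \<mu>"
    and \<mu>_cont: "narrowly_continuous T \<mu>"
    and \<psi>s_reg: "C12b T \<psi>s \<psi>st \<psi>sx \<psi>sxx"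
    and \<phi>_meas: "(\<lambda>(t,x). \<phi> t x) \<in> measurable (restrict_space borel ({0..T} \<times> UNIV)) borel"
    and \<phi>_min: "\<forall>t\<in>{0..T}. \<forall>x. \<forall>a. a \<noteq> \<phi> t x \<longrightarrow>
        Ham b \<sigma> f t x (\<psi>sx t x) (\<psi>sxx t x) (\<phi> t x) (\<mu> t)
          < Ham b \<sigma> f t x (\<psi>sx t x) (\<psi>sxx t x) a (\<mu> t)"
    and g_cont: "continuous_on UNIV (\<lambda>x. g x (\<mu> T))"
    and minH_cont: "continuous_on ({0..T} \<times> UNIV)
        (\<lambda>(t,x). INF a. Ham b \<sigma> f t x (\<psi>sx t x) (\<psi>sxx t x) a (\<mu> t))"
    and full_supp: "\<forall>t\<in>{0<..T}. supp (\<mu> t) = UNIV"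
    and \<xi>_Mplus: "\<xi> \<in> Mplus T"
  shows "PD T \<rho> b \<sigma> f g \<mu> \<xi> \<psi>s \<psi>st \<psi>sx \<psi>sxx \<longleftrightarrow>
     (\<forall>E\<in>sets \<xi>. emeasure \<xi> E =
        (\<integral>\<^sup>+ t. indicator {0..T} t * (\<integral>\<^sup>+ x. indicator E (t, x, \<phi> t x) \<partial>\<mu> t) \<partial>lborel)) \<and>
     (\<forall>\<psi> \<psi>t \<psi>x \<psi>xx. C12b T \<psi> \<psi>t \<psi>x \<psi>xx \<longrightarrow>
        integral\<^sup>L (\<mu> T) (\<lambda>x. \<psi> T x) - integral\<^sup>L \<rho> (\<lambda>x. \<psi> 0 x)
        = tx_integral T \<mu> (\<lambda>t x. Lgen b \<sigma> \<mu> \<psi>x \<psi>xx t x (\<phi> t x) + \<psi>t t x)) \<and>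
     (\<forall>t\<in>{0..T}. \<forall>x. \<psi>st t x + (INF a. Ham b \<sigma> f t x (\<psi>sx t x) (\<psi>sxx t x) a (\<mu> t)) = 0) \<and>
     (\<forall>x. \<psi>s T x = g x (\<mu> T))"
proof -
  interpret feedback_kernel T \<mu> \<phi>
    using T_pos \<mu>_kernel \<phi>_meas by unfold_locales
  let ?S = "{0..T} \<times> UNIV"
  let ?\<nu> = "graph_measure T \<mu> \<phi>"
  let ?Ham = "\<lambda>t x a. Ham b \<sigma> f t x (\<psi>sx t x) (\<psi>sxx t x) a (\<mu> t)"
  let ?L = "\<lambda>t x a. Lgen b \<sigma> \<mu> \<psi>sx \<psi>sxx t x a"
  \<comment> \<open>\<open>h\<close> is the residual of the Hamilton-Jacobi-Bellman equation in (b),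
    and \<open>F\<close> below is the defect of (iv). For times in \<open>{0..T}\<close>,
    \<open>h\<close> is the minimum of \<open>F\<close> over the actions, attained only at
    \<open>\<phi>\<close>.\<close>
  define h where "h t x = \<psi>st t x + (INF a. ?Ham t x a)" for t x
  define F where "F t x a = \<psi>st t x + ?L t x a + f t x a (\<mu> t)" for t x a
  have fin: "finite_measure \<xi>" and sets\<xi>: "sets \<xi> = sets (TXA T)"
    using \<xi>_Mplus by (auto simp: Mplus_def)
  have space\<xi>: "space \<xi> = ?S"
    using sets_eq_imp_space_eq[OF sets\<xi>] by (simp add: space_TXA)

  have INF_Ham: "(INF a. ?Ham t x a) = ?Ham t x (\<phi> t x)" if "t \<in> {0..T}" for t x
  proof (rule cInf_eq_minimum)
    fix y assume "y \<in> range (?Ham t x)"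
    then obtain a where "y = ?Ham t x a" by blast
    then show "?Ham t x (\<phi> t x) \<le> y"
      using \<phi>_min that by (cases "a = \<phi> t x") (auto intro: less_imp_le)
  qed simp
  have F_Ham: "F t x a = \<psi>st t x + ?Ham t x a" for t x a
    by (simp add: F_def Ham_def Lgen_def)
  have h_eq: "h t x = F t x (\<phi> t x)" if "t \<in> {0..T}" for t x
    using INF_Ham[OF that] by (simp add: h_def F_Ham)
  have h_less: "h t x < F t x a" if "t \<in> {0..T}" "a \<noteq> \<phi> t x" for t x a
    using \<phi>_min that by (simp add: h_eq F_Ham)
  have h_le: "h t x \<le> F t x a" if "t \<in> {0..T}" for t x a
    using h_less[OF that, of a x] h_eq[OF that, of x] by (cases "a = \<phi> t x") auto
  have h_cont: "continuous_on ?S (\<lambda>(t,x). h t x)"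
    using continuous_on_add[OF _ minH_cont, of "\<lambda>(t,x). \<psi>st t x"] \<psi>s_reg
    by (simp add: h_def C12b_def case_prod_unfold)

  \<comment> \<open>The setwise description of \<open>\<xi>\<close> is traded for an equality of
    measures, so that integrals against \<open>\<xi>\<close> can be rewritten as integrals over the
    graph.\<close>
  have \<xi>_iff: "(\<forall>E\<in>sets \<xi>. emeasure \<xi> E =
        (\<integral>\<^sup>+ t. indicator {0..T} t * (\<integral>\<^sup>+ x. indicator E (t, x, \<phi> t x) \<partial>\<mu> t) \<partial>lborel)) \<longleftrightarrow> \<xi> = ?\<nu>"
    using emeasure_graph_measure sets\<xi> sets_graph_measure
    by (auto intro!: measure_eqI)

  have m_gen: "(\<lambda>(t,x,a). Lgen b \<sigma> \<mu> \<psi>x \<psi>xx t x a + \<psi>t t x) \<in> borel_measurable (TXA T)"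
      "bounded ((\<lambda>(t,x,a). Lgen b \<sigma> \<mu> \<psi>x \<psi>xx t x a + \<psi>t t x) ` ?S)"
    if "C12b T \<psi> \<psi>t \<psi>x \<psi>xx" for \<psi> \<psi>t \<psi>x \<psi>xx
    using borel_measurable_add[OF Lgen_measurable_bounded(1)[OF b_ok \<sigma>_ok that] C12b_measurable(2)[OF that]]
      bounded_plus_comp[OF Lgen_measurable_bounded(2)[OF b_ok \<sigma>_ok that] C12b_bounded(2)[OF that]]
    by (simp_all add: case_prod_unfold)
  note m_f = coeff_ok_along_\<mu>[OF f_ok]
  have F_split: "(\<lambda>(t,x,a). F t x a) = (\<lambda>p. (\<lambda>(t,x,a). ?L t x a + \<psi>st t x) p + (\<lambda>(t,x,a). f t x a (\<mu> t)) p)"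
    by (auto simp: F_def)
  have m_F: "(\<lambda>(t,x,a). F t x a) \<in> borel_measurable (TXA T)" "bounded ((\<lambda>(t,x,a). F t x a) ` ?S)"
    unfolding F_split using m_gen[OF \<psi>s_reg] m_f by (intro borel_measurable_add bounded_plus_comp; simp)+
  have int_F: "integral\<^sup>L \<xi> (\<lambda>(t,x,a). F t x a) =
      integral\<^sup>L \<xi> (\<lambda>(t,x,a). ?L t x a + \<psi>st t x) + integral\<^sup>L \<xi> (\<lambda>(t,x,a). f t x a (\<mu> t))"
    unfolding F_split
    by (intro Bochner_Integration.integral_add integrable_Mplus[OF \<xi>_Mplus] m_gen[OF \<psi>s_reg] m_f)

  have gen_eq: "integral\<^sup>L \<xi> (\<lambda>(t,x,a). Lgen b \<sigma> \<mu> \<psi>x \<psi>xx t x a + \<psi>t t x) =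
      tx_integral T \<mu> (\<lambda>t x. Lgen b \<sigma> \<mu> \<psi>x \<psi>xx t x (\<phi> t x) + \<psi>t t x)"
    if "\<xi> = ?\<nu>" "C12b T \<psi> \<psi>t \<psi>x \<psi>xx" for \<psi> \<psi>t \<psi>x \<psi>xx
    using integral_graph_measure[OF m_gen[OF that(2)]] that(1) by simp

  show ?thesis
    unfolding \<xi>_iff
  proof (intro iffI conjI)
    assume PD: "PD T \<rho> b \<sigma> f g \<mu> \<xi> \<psi>s \<psi>st \<psi>sx \<psi>sxx"
    note PD' = PD[unfolded PD_def]
    have T: "T \<in> {0..T}" using T_pos by simp
    interpret \<mu>T: prob_space "\<mu> T" using \<mu>_prob[OF T] .
    have c\<psi>: "continuous_on UNIV (\<psi>s t)" if "t \<in> {0..T}" for t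
      using \<psi>s_reg that by (auto simp: C12b_def intro!: has_derivative_continuous_on)
    have int_b: "integrable (\<mu> T) w" if cw: "continuous_on UNIV w" and bw: "bounded (range w)" for w :: "real^'n \<Rightarrow> real"
    proof -
      obtain B where "\<And>x. norm (w x) \<le> B" using bw by (auto simp: bounded_iff)
      moreover have "w \<in> borel_measurable (\<mu> T)"
        using borel_measurable_continuous_onI[OF cw] \<mu>_sets[OF T] by (simp cong: measurable_cong_sets)
      ultimately show ?thesis by (intro \<mu>T.integrable_const_bound[where B=B]) auto
    qed
    have int_g: "integrable (\<mu> T) (\<lambda>x. g x (\<mu> T))"
    proof (rule int_b[OF g_cont])
      have "bounded ((\<lambda>(x,m). g x m) ` (UNIV \<times> Pspace TYPE('n)))" using g_ok by (simp add: term_ok_def)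
      then show "bounded (range (\<lambda>x. g x (\<mu> T)))"
        by (rule bounded_subset) (use \<mu>_Pspace[OF T] in auto)
    qed
    have int_\<psi>: "integrable (\<mu> T) (\<psi>s T)"
    proof (rule int_b[OF c\<psi>[OF T]])
      have "bounded ((\<lambda>(t,x). \<psi>s t x) ` ?S)" using \<psi>s_reg by (simp add: C12b_def)
      then show "bounded (range (\<psi>s T))" by (rule bounded_subset) (use T in auto)
    qed
    have F_nonneg: "0 \<le> F t x a" if "t \<in> {0..T}" for t x a
      using PD' that by (simp add: F_def)
    have int_F_nonneg: "0 \<le> integral\<^sup>L \<xi> (\<lambda>(t,x,a). F t x a)"
      using F_nonneg space\<xi> by (intro integral_nonneg_AE AE_I2) auto
    have int_gap_nonneg: "0 \<le> (\<integral>x. g x (\<mu> T) - \<psi>s T x \<partial>\<mu> T)"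
      using PD' by (intro integral_nonneg_AE AE_I2) simp
    have "(\<integral>x. g x (\<mu> T) - \<psi>s T x \<partial>\<mu> T) + integral\<^sup>L \<xi> (\<lambda>(t,x,a). F t x a) = 0"
    proof -
      have "integral\<^sup>L (\<mu> T) (\<psi>s T) - integral\<^sup>L \<rho> (\<psi>s 0) = integral\<^sup>L \<xi> (\<lambda>(t,x,a). ?L t x a + \<psi>st t x)"
        using PD' \<psi>s_reg by blast
      moreover have "integral\<^sup>L (\<mu> T) (\<lambda>x. g x (\<mu> T)) + integral\<^sup>L \<xi> (\<lambda>(t,x,a). f t x a (\<mu> t)) = integral\<^sup>L \<rho> (\<psi>s 0)"
        using PD' by blast
      ultimately show ?thesis
        using int_g int_\<psi> by (simp add: int_F)
    qed
    with int_F_nonneg int_gap_nonneg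
    have zero: "(\<integral>x. g x (\<mu> T) - \<psi>s T x \<partial>\<mu> T) = 0" "integral\<^sup>L \<xi> (\<lambda>(t,x,a). F t x a) = 0" by auto

    have "AE x in \<mu> T. g x (\<mu> T) - \<psi>s T x = 0"
      using zero(1) PD' int_g int_\<psi> by (subst (asm) integral_nonneg_eq_0_iff_AE) auto
    then have "AE x in \<mu> T. \<psi>s T x = g x (\<mu> T)" by eventually_elim simp
    moreover have "supp (\<mu> T) = UNIV" using full_supp T_pos by simp
    ultimately show "\<forall>x. \<psi>s T x = g x (\<mu> T)"
      using supp_UNIV_AE_continuous_eq[OF \<mu>_sets[OF T] _ c\<psi>[OF T] g_cont] by blast

    have "AE p in \<xi>. (\<lambda>(t,x,a). F t x a) p = 0"
      using zero(2) F_nonneg space\<xi> integrable_Mplus[OF \<xi>_Mplus m_F]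
      by (subst (asm) integral_nonneg_eq_0_iff_AE) (auto intro!: AE_I2)
    moreover have "AE p in \<xi>. p \<in> ?S" by (rule AE_I2) (simp add: space\<xi>)
    ultimately have F0: "AE p in \<xi>. p \<in> ?S \<and> (\<lambda>(t,x,a). F t x a) p = 0"
      by eventually_elim simp
    have h_nonneg: "0 \<le> h t x" if "t \<in> {0..T}" for t x
      using h_eq[OF that] F_nonneg[OF that] by simp
    show \<xi>_eq: "\<xi> = ?\<nu>"
    proof (rule graph_measure_eqI[OF fin sets\<xi>])
      \<comment> \<open>An action other than \<open>\<phi>\<close> would give
        \<open>0 \<le> h < F\<close> by strict minimality, against \<open>F = 0\<close>.\<close>
      show "AE p in \<xi>. snd (snd p) = \<phi> (fst p) (fst (snd p))"
        using F0
      proof eventually_elim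
        case (elim p)
        then show ?case
          using h_less[of "fst p" "snd (snd p)" "fst (snd p)"] h_nonneg[of "fst p" "fst (snd p)"]
          by (fastforce simp: case_prod_unfold)
      qed
    qed (use PD' in blast)
    show "\<forall>\<psi> \<psi>t \<psi>x \<psi>xx. C12b T \<psi> \<psi>t \<psi>x \<psi>xx \<longrightarrow>
        integral\<^sup>L (\<mu> T) (\<lambda>x. \<psi> T x) - integral\<^sup>L \<rho> (\<lambda>x. \<psi> 0 x)
        = tx_integral T \<mu> (\<lambda>t x. Lgen b \<sigma> \<mu> \<psi>x \<psi>xx t x (\<phi> t x) + \<psi>t t x)"
    proof (intro allI impI)
      fix \<psi> :: "real \<Rightarrow> real^'n \<Rightarrow> real" and \<psi>t \<psi>x \<psi>xx
      assume \<psi>: "C12b T \<psi> \<psi>t \<psi>x \<psi>xx"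
      then have "integral\<^sup>L (\<mu> T) (\<lambda>x. \<psi> T x) - integral\<^sup>L \<rho> (\<lambda>x. \<psi> 0 x)
        = integral\<^sup>L \<xi> (\<lambda>(t,x,a). Lgen b \<sigma> \<mu> \<psi>x \<psi>xx t x a + \<psi>t t x)"
        using PD' by blast
      then show "integral\<^sup>L (\<mu> T) (\<lambda>x. \<psi> T x) - integral\<^sup>L \<rho> (\<lambda>x. \<psi> 0 x)
        = tx_integral T \<mu> (\<lambda>t x. Lgen b \<sigma> \<mu> \<psi>x \<psi>xx t x (\<phi> t x) + \<psi>t t x)"
        using gen_eq[OF \<xi>_eq \<psi>] by simp
    qed

    have m_h: "(\<lambda>(t,x,a::'a). h t x) \<in> borel_measurable (TXA T)"
      by (rule continuous_on_measurable_TXA[OF h_cont])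
    \<comment> \<open>Squeezed by \<open>0 \<le> h \<le> F = 0\<close>.\<close>
    have "AE p in ?\<nu>. (\<lambda>(t,x,a). h t x) p = 0"
      using F0 unfolding \<xi>_eq[symmetric]
    proof eventually_elim
      case (elim p)
      then show ?case
        using h_le[of "fst p" "fst (snd p)" "snd (snd p)"] h_nonneg[of "fst p" "fst (snd p)"]
        by (auto simp: case_prod_unfold)
    qed
    from AE_graph_measure[OF _ this] m_h
    have "AE t in time. AE x in \<mu> t. h t x = 0" by simp
    moreover have "AE t in time. t \<in> {0..T}" by (rule AE_I2) (simp add: space_time)
    \<comment> \<open>Full support is assumed only for positive times, so the null set of the
      initial time is discarded.\<close>
    moreover have "AE t in time. t \<noteq> 0"
    proof (subst AE_restrict_space_iff)
      show "AE t in lborel. t \<in> {0..T} \<longrightarrow> t \<noteq> 0"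
        using AE_lborel_singleton[of "0::real"] by eventually_elim simp
    qed simp
    \<comment> \<open>Continuity in space with full support upgrades each good slice to all
      \<open>x\<close>. The exceptional set of times is then the same for every
      \<open>x\<close>.\<close>
    ultimately have ae: "AE t in time. \<forall>x. h t x = 0"
    proof eventually_elim
      case (elim t)
      have "continuous_on UNIV (\<lambda>x. (\<lambda>(t,x). h t x) (t, x))"
        by (rule continuous_on_compose2[OF h_cont]) (use elim in \<open>auto intro!: continuous_intros\<close>)
      then show ?case
        using supp_UNIV_AE_continuous_eq[OF \<mu>_sets[of t], of "h t" "\<lambda>_. 0"] full_supp elim by auto
    qed
    show "\<forall>t\<in>{0..T}. \<forall>x. \<psi>st t x + (INF a. ?Ham t x a) = 0"
    proof (intro ballI allI)
      fix t x assume t: "t \<in> {0..T}"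
      \<comment> \<open>With \<open>x\<close> fixed, continuity in time now reaches the exceptional
        times, the initial one included.\<close>
      have "continuous_on {0..T} (\<lambda>t. (\<lambda>(t,x). h t x) (t, x))"
        by (rule continuous_on_compose2[OF h_cont]) (auto intro!: continuous_intros)
      then have "h t x = 0"
        using ae t by (intro AE_continuous_zero_imp_zero[OF T_pos, of "\<lambda>t. h t x"]) auto
      then show "\<psi>st t x + (INF a. ?Ham t x a) = 0" by (simp add: h_def)
    qed
  next
    assume R: "\<xi> = ?\<nu> \<and>
     (\<forall>\<psi> \<psi>t \<psi>x \<psi>xx. C12b T \<psi> \<psi>t \<psi>x \<psi>xx \<longrightarrow>
        integral\<^sup>L (\<mu> T) (\<lambda>x. \<psi> T x) - integral\<^sup>L \<rho> (\<lambda>x. \<psi> 0 x)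
        = tx_integral T \<mu> (\<lambda>t x. Lgen b \<sigma> \<mu> \<psi>x \<psi>xx t x (\<phi> t x) + \<psi>t t x)) \<and>
     (\<forall>t\<in>{0..T}. \<forall>x. \<psi>st t x + (INF a. ?Ham t x a) = 0) \<and>
     (\<forall>x. \<psi>s T x = g x (\<mu> T))"
    then have \<xi>_eq: "\<xi> = ?\<nu>" and g_eq: "\<And>x. g x (\<mu> T) = \<psi>s T x"
      and h0: "\<And>t x. t \<in> {0..T} \<Longrightarrow> h t x = 0"
      by (auto simp: h_def)
    have ii: "integral\<^sup>L (\<mu> T) (\<lambda>x. \<psi> T x) - integral\<^sup>L \<rho> (\<lambda>x. \<psi> 0 x)
        = integral\<^sup>L \<xi> (\<lambda>(t,x,a). Lgen b \<sigma> \<mu> \<psi>x \<psi>xx t x a + \<psi>t t x)"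
      if "C12b T \<psi> \<psi>t \<psi>x \<psi>xx" for \<psi> \<psi>t \<psi>x \<psi>xx
      using R that gen_eq[OF \<xi>_eq that] by simp
    \<comment> \<open>On the graph \<open>F\<close> equals \<open>h\<close>, which vanishes by (b).
      So the integral of \<open>f\<close> is minus that of the generator part, and (ii) for
      \<open>\<psi>s\<close> together with the terminal condition turns this into (i).\<close>
    have "integral\<^sup>L \<xi> (\<lambda>(t,x,a). F t x a) = tx_integral T \<mu> (\<lambda>t x. F t x (\<phi> t x))"
      using integral_graph_measure[OF m_F] \<xi>_eq by simp
    also have "\<dots> = 0"
      unfolding tx_integral_def using h0 h_eq
      by (intro integral_eq_zero_AE AE_I2) (simp add: space_time)
    finally have "integral\<^sup>L (\<mu> T) (\<lambda>x. g x (\<mu> T)) + integral\<^sup>L \<xi> (\<lambda>(t,x,a). f t x a (\<mu> t)) = integral\<^sup>L \<rho> (\<lambda>x. \<psi>s 0 x)"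
      using ii[OF \<psi>s_reg] by (simp add: int_F g_eq)
    \<comment> \<open>The left-hand side is \<open>F\<close>, which lies above its minimum
      \<open>h = 0\<close>.\<close>
    moreover have "\<psi>st t x + ?L t x a + f t x a (\<mu> t) \<ge> 0" if "t \<in> {0..T}" for t x a
      using h_le[OF that] h0[OF that] by (metis F_def)
    moreover have "tx_integral T \<mu> \<psi> = integral\<^sup>L \<xi> (\<lambda>(t,x,a). \<psi> t x)"
      if "C12b T \<psi> \<psi>t \<psi>x \<psi>xx" for \<psi> \<psi>t \<psi>x \<psi>xx
      using integral_graph_measure[OF C12b_measurable(1)[OF that] C12b_bounded(1)[OF that]] \<xi>_eq by simp
    ultimately show "PD T \<rho> b \<sigma> f g \<mu> \<xi> \<psi>s \<psi>st \<psi>sx \<psi>sxx"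
      unfolding PD_def using ii g_eq by auto
  qed
qed

end
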